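(* Let $r\ge 2$, let $s_1,s_2,\dots,s_{r-1}$ be positive integers and let $H$ be any $r$-uniform hypergraph with $v=|V(H)|$ vertices and $e=|E(H)|$ edges. Then there exists a constant $c>0$ such that for every integer $p\ge c$, $$ex\big(n,H,K^{(r)}_{s_1,s_2,\dots,s_{r-1},p}\big)=\Omega\!\left(n^{\,v-\frac{e}{s_1s_2\cdots s_{r-1}}}\right)$$ as $n\to\infty$.
   Context: For $r$-uniform hypergraphs $T$ and $F$, $ex(n,T,F)$ denotes the maximum number of copies of $T$ (subhypergraphs isomorphic to $T$) in an $n$-vertex $r$-uniform hypergraph containing no subhypergraph isomorphic to $F$. $K^{(r)}_{t_1,\dots,t_r}$ denotes the complete $r$-partite $r$-uniform hypergraph with parts of sizes $t_1,\dots,t_r$: its vertex set is a disjoint union of parts $V_1,\dots,V_r$ with $|V_i|=t_i$, and its edges are exactly the $r$-sets containing one vertex from each part. *)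

theory Defs
  imports Complex_Main "HOL-Library.Landau_Symbols"
begin

datatype 'a hypergraph = Hypergraph (verts: "'a set") (edges: "'a set set")

definition uniform_hypergraph :: "nat \<Rightarrow> 'a hypergraph \<Rightarrow> bool" where
  "uniform_hypergraph r H \<longleftrightarrow>
     finite (verts H) \<and> (\<forall>e\<in>edges H. e \<subseteq> verts H \<and> card e = r)"

definition isomorphic_hypergraphs :: "'a hypergraph \<Rightarrow> 'b hypergraph \<Rightarrow> bool" where
  "isomorphic_hypergraphs G H \<longleftrightarrow>
     (\<exists>f. bij_betw f (verts G) (verts H) \<and> edges H = (\<lambda>e. f ` e) ` edges G)"

text \<open>Subhypergraphs need not be induced, and they carry their own vertex set, so isolated
  vertices of the counted hypergraph matter.\<close>

definition subhypergraph :: "nat \<Rightarrow> 'a hypergraph \<Rightarrow> 'a hypergraph \<Rightarrow> bool" where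
  "subhypergraph r S G \<longleftrightarrow>
     uniform_hypergraph r S \<and> verts S \<subseteq> verts G \<and> edges S \<subseteq> edges G"

definition copies :: "nat \<Rightarrow> 'a hypergraph \<Rightarrow> 'b hypergraph \<Rightarrow> 'b hypergraph set" where
  "copies r T G = {S. subhypergraph r S G \<and> isomorphic_hypergraphs T S}"

definition hypergraph_free :: "nat \<Rightarrow> 'a hypergraph \<Rightarrow> 'b hypergraph \<Rightarrow> bool" where
  "hypergraph_free r F G \<longleftrightarrow> copies r F G = {}"

text \<open>The numbers over which \<open>ex(n,T,F)\<close> maximises.  Every finite hypergraph is isomorphic to one
  on natural numbers, so vertices of the hosts are taken there.\<close>

definition copy_counts :: "nat \<Rightarrow> nat \<Rightarrow> 'a hypergraph \<Rightarrow> 'b hypergraph \<Rightarrow> nat set" where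
  "copy_counts r n T F =
     {card (copies r T G) | G :: nat hypergraph.
        uniform_hypergraph r G \<and> card (verts G) = n \<and> hypergraph_free r F G}"

definition ex_number :: "nat \<Rightarrow> nat \<Rightarrow> 'a hypergraph \<Rightarrow> 'b hypergraph \<Rightarrow> nat" where
  "ex_number r n T F = Max (copy_counts r n T F)"

text \<open>The \<open>i\<close>-th part consists of the pairs \<open>(i, j)\<close> with \<open>j < ts ! i\<close>, where \<open>i\<close> counts from 0.\<close>

definition part :: "nat list \<Rightarrow> nat \<Rightarrow> (nat \<times> nat) set" where
  "part ts i = {i} \<times> {..<ts ! i}"

definition complete_partite :: "nat list \<Rightarrow> (nat \<times> nat) hypergraph" where
  "complete_partite ts = (let V = (\<Union>i<length ts. part ts i) in
     Hypergraph V {e. e \<subseteq> V \<and> card e = length ts \<and> (\<forall>i<length ts. card (e \<inter> part ts i) = 1)})"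

text \<open>The maximum is over a finite set, and over a nonempty one as soon as \<open>F\<close> has an edge.\<close>

lemma finite_hypergraphs_within:
  assumes "finite A" "finite B"
  shows "finite {S. verts S \<subseteq> A \<and> edges S \<subseteq> B}"
    and "card {S. verts S \<subseteq> A \<and> edges S \<subseteq> B} \<le> 2 ^ card A * 2 ^ card B"
proof -
  have sub: "{S. verts S \<subseteq> A \<and> edges S \<subseteq> B}
      \<subseteq> (\<lambda>(V, E). Hypergraph V E) ` (Pow A \<times> Pow B)"
  proof
    fix S assume "S \<in> {S. verts S \<subseteq> A \<and> edges S \<subseteq> B}"
    then show "S \<in> (\<lambda>(V, E). Hypergraph V E) ` (Pow A \<times> Pow B)"
      by (intro image_eqI[of _ _ "(verts S, edges S)"]) auto
  qed
  have fin: "finite (Pow A \<times> Pow B)" using assms by simp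
  show "finite {S. verts S \<subseteq> A \<and> edges S \<subseteq> B}"
    using sub fin by (meson finite_imageI finite_subset)
  have "card {S. verts S \<subseteq> A \<and> edges S \<subseteq> B} \<le> card (Pow A \<times> Pow B)"
    using sub fin by (meson card_image_le card_mono finite_imageI le_trans)
  then show "card {S. verts S \<subseteq> A \<and> edges S \<subseteq> B} \<le> 2 ^ card A * 2 ^ card B"
    using assms by (simp add: card_Pow card_cartesian_product)
qed

lemma finite_edges:
  assumes "uniform_hypergraph r G"
  shows "finite (edges G)" "card (edges G) \<le> 2 ^ card (verts G)"
proof -
  have "edges G \<subseteq> Pow (verts G)" and "finite (verts G)"
    using assms by (auto simp: uniform_hypergraph_def)
  then show "finite (edges G)" "card (edges G) \<le> 2 ^ card (verts G)"
    using card_mono[of "Pow (verts G)" "edges G"] by (auto simp: card_Pow intro: finite_subset)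
qed

lemma copies_within: "copies r T G \<subseteq> {S. verts S \<subseteq> verts G \<and> edges S \<subseteq> edges G}"
  by (auto simp: copies_def subhypergraph_def)

lemma finite_copies:
  assumes "uniform_hypergraph r G"
  shows "finite (copies r T G)"
proof (rule finite_subset[OF copies_within finite_hypergraphs_within(1)])
  show "finite (verts G)" using assms by (simp add: uniform_hypergraph_def)
  show "finite (edges G)" using assms by (rule finite_edges(1))
qed

lemma finite_copy_counts: "finite (copy_counts r n T F)"
proof -
  have "card (copies r T G) \<le> 2 ^ n * 2 ^ (2 ^ n)"
    if G: "uniform_hypergraph r G" "card (verts G) = n" for G :: "nat hypergraph"
  proof -
    have fin: "finite (verts G)" using G(1) by (simp add: uniform_hypergraph_def)
    have "card (copies r T G) \<le> card {S. verts S \<subseteq> verts G \<and> edges S \<subseteq> edges G}"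
      by (rule card_mono[OF finite_hypergraphs_within(1)[OF fin finite_edges(1)[OF G(1)]]
            copies_within])
    also have "\<dots> \<le> 2 ^ n * 2 ^ card (edges G)"
      using finite_hypergraphs_within(2)[OF fin finite_edges(1)[OF G(1)]] G(2) by simp
    also have "\<dots> \<le> 2 ^ n * 2 ^ (2 ^ n)"
      using finite_edges(2)[OF G(1)] G(2) by simp
    finally show ?thesis .
  qed
  then have "copy_counts r n T F \<subseteq> {..2 ^ n * 2 ^ (2 ^ n)}"
    by (auto simp: copy_counts_def)
  then show ?thesis by (rule finite_subset) simp
qed

lemma copy_counts_nonempty:
  assumes "edges F \<noteq> {}"
  shows "copy_counts r n T F \<noteq> {}"
proof -
  have "hypergraph_free r F (Hypergraph {..<n} {})"
    using assms
    by (auto simp: hypergraph_free_def copies_def subhypergraph_def isomorphic_hypergraphs_def)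
  moreover have "uniform_hypergraph r (Hypergraph {..<n} {})"
    by (simp add: uniform_hypergraph_def)
  ultimately have "card (copies r T (Hypergraph {..<n} {})) \<in> copy_counts r n T F"
    unfolding copy_counts_def by force
  then show ?thesis by blast
qed

end

theory Submission
  imports "HOL-Algebra.Algebraic_Closure_Type" "HOL-Library.Z2" "Jordan_Normal_Form.Char_Poly" Defs
begin

text \<open>Let \<open>k = s\<^sub>1 \<cdots> s\<^sub>r\<^sub>-\<^sub>1\<close>, \<open>v = |V(H)|\<close>, \<open>e = |E(H)|\<close>, and let \<open>K\<close> be the field with
  \<open>q = 2 ^ a\<close> elements.  The host has vertex set \<open>V(H) \<times> K ^ k\<close>; an \<open>r\<close>-set whose colours form an edge
  of \<open>H\<close> is made an edge if a random polynomial of bounded degree in each coordinate vanishes on it.  Each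
  of the \<open>q ^ (k v)\<close> colour-preserving placements of \<open>H\<close> survives with probability
  \<open>q ^ (- e)\<close>, which gives about \<open>n ^ (v - e / k)\<close> copies.

  Fixing the first \<open>r - 1\<close> parts of a complete \<open>r\<close>-partite subhypergraph, the vertices of one colour in
  the last part are common zeros of \<open>k\<close> random polynomials in \<open>k\<close> variables.  Instead of the
  Lang--Weil bound we use elimination: restricted to a slice \<open>x\<^sub>j = \<tau>\<close>, the system consists of \<open>k\<close>
  polynomials in \<open>k - 1\<close> variables, and outside an event of probability \<open>O(1 / q)\<close> some
  resultant-like determinant does not vanish at \<open>\<tau>\<close>.  This determinant is a polynomial in the
  slice parameter, so if it is nonzero at a single \<open>\<tau>\<close>, then \<open>x\<^sub>j\<close> takes boundedly many values on the
  common zeros.  The slices at \<open>t\<close> different values of \<open>\<tau>\<close> behave independently, so failure has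
  probability \<open>O(q ^ (- t))\<close>, and a union bound over all choices of the first \<open>r - 1\<close> parts applies
  once \<open>t\<close> is large.\<close>

subsection \<open>Interpolation and determinants over a field\<close>

text \<open>Polynomials are kept as functions with a degree bound, so that freezing and substituting
  variables is plain function application.\<close>

definition polydeg :: "nat \<Rightarrow> ('f::field \<Rightarrow> 'f) \<Rightarrow> bool" where
  "polydeg d u \<longleftrightarrow> (\<exists>p. degree p \<le> d \<and> u = poly p)"

lemma polydeg_const: "polydeg d (\<lambda>y. c)"
  unfolding polydeg_def by (rule exI[of _ "[:c:]"]) auto

lemma polydeg_add: "polydeg d u \<Longrightarrow> polydeg d v \<Longrightarrow> polydeg d (\<lambda>y. u y + v y)"
  unfolding polydeg_def
proof (elim exE conjE)
  fix p q :: "'a poly"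
  assume "degree p \<le> d" "u = poly p" "degree q \<le> d" "v = poly q"
  then show "\<exists>r. degree r \<le> d \<and> (\<lambda>y. u y + v y) = poly r"
    by (intro exI[of _ "p + q"]) (auto intro: degree_add_le)
qed

lemma polydeg_mult:
  "polydeg a u \<Longrightarrow> polydeg b v \<Longrightarrow> a + b \<le> d \<Longrightarrow> polydeg d (\<lambda>y. u y * v y)"
  unfolding polydeg_def
proof (elim exE conjE)
  fix p q :: "'a poly"
  assume "degree p \<le> a" "u = poly p" "degree q \<le> b" "v = poly q" "a + b \<le> d"
  then show "\<exists>r. degree r \<le> d \<and> (\<lambda>y. u y * v y) = poly r"
    using degree_mult_le[of p q] by (intro exI[of _ "p * q"]) auto
qed

lemma polydeg_cmult: "polydeg d u \<Longrightarrow> polydeg d (\<lambda>y. c * u y)"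
  by (rule polydeg_mult[OF polydeg_const[of 0]]) auto

lemma polydeg_multc: "polydeg d u \<Longrightarrow> polydeg d (\<lambda>y. u y * c)"
  by (rule polydeg_mult[OF _ polydeg_const[of 0]]) auto

lemma polydeg_mono: "polydeg a u \<Longrightarrow> a \<le> b \<Longrightarrow> polydeg b u"
  unfolding polydeg_def using le_trans by blast

lemma polydeg_sum: "(\<And>i. i \<in> I \<Longrightarrow> polydeg d (u i)) \<Longrightarrow> polydeg d (\<lambda>y. \<Sum>i\<in>I. u i y)"
  by (induction I rule: infinite_finite_induct) (auto intro: polydeg_add polydeg_const)

lemma polydeg_power: "polydeg d (\<lambda>y. y ^ d)"
  unfolding polydeg_def by (rule exI[of _ "monom 1 d"]) (auto simp: poly_monom degree_monom_eq)

lemma polydeg_linear: "polydeg 1 (\<lambda>y. (y - a) / b)"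
  unfolding polydeg_def
  by (rule exI[of _ "[:- a / b, inverse b:]"]) (auto simp: divide_inverse algebra_simps)

lemma polydeg_prod:
  "finite I \<Longrightarrow> (\<And>i. i \<in> I \<Longrightarrow> polydeg 1 (u i)) \<Longrightarrow> polydeg (card I) (\<lambda>y. \<Prod>i\<in>I. u i y)"
  by (induction I rule: finite_induct) (auto intro: polydeg_const polydeg_mult[of 1])

lemma polydeg_eqI:
  assumes "polydeg N u" "polydeg N v" "finite A" "N < card A" "\<And>\<alpha>. \<alpha> \<in> A \<Longrightarrow> u \<alpha> = v \<alpha>"
  shows "u y = v y"
proof -
  obtain p q where p: "degree p \<le> N" "u = poly p" and q: "degree q \<le> N" "v = poly q"
    using assms by (auto simp: polydeg_def)
  have "p = q"
  proof (rule ccontr)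
    assume "p \<noteq> q"
    then have nz: "p - q \<noteq> 0" by simp
    have "card A \<le> card {x. poly (p - q) x = 0}"
      using assms p q poly_roots_finite[OF nz] by (intro card_mono) auto
    also have "\<dots> \<le> degree (p - q)" using nz by (rule card_poly_roots_bound)
    also have "\<dots> \<le> N" using p q by (intro degree_diff_le) auto
    finally show False using assms by simp
  qed
  then show ?thesis using p q by simp
qed

text \<open>The Lagrange basis polynomial of the node \<open>\<alpha>\<close> on the node set
  \<open>A\<close>.\<close>

definition lag :: "'f::field set \<Rightarrow> 'f \<Rightarrow> 'f \<Rightarrow> 'f" where
  "lag A \<alpha> y = (\<Prod>\<beta>\<in>A - {\<alpha>}. (y - \<beta>) / (\<alpha> - \<beta>))"

lemma polydeg_lag:
  assumes "finite A" "\<alpha> \<in> A" "card A \<le> Suc N"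
  shows "polydeg N (lag A \<alpha>)"
proof -
  have "polydeg (card (A - {\<alpha>})) (lag A \<alpha>)"
    unfolding lag_def using assms by (intro polydeg_prod polydeg_linear) auto
  then show ?thesis by (rule polydeg_mono) (use assms in simp)
qed

lemma lag_delta:
  assumes "finite A" "\<alpha> \<in> A" "\<beta> \<in> A"
  shows "lag A \<alpha> \<beta> = (if \<alpha> = \<beta> then 1 else 0)"
proof (cases "\<alpha> = \<beta>")
  case True
  have "lag A \<alpha> \<alpha> = 1" unfolding lag_def by (rule prod.neutral) auto
  then show ?thesis using True by simp
next
  case False
  then show ?thesis using assms by (auto simp: lag_def intro!: bexI[of _ \<beta>])
qed

lemma lag_interp:
  assumes "finite A" "card A = Suc N" "polydeg N u"
  shows "u y = (\<Sum>\<alpha>\<in>A. lag A \<alpha> y * u \<alpha>)"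
proof (rule polydeg_eqI[OF assms(3) _ assms(1)])
  show "polydeg N (\<lambda>y. \<Sum>\<alpha>\<in>A. lag A \<alpha> y * u \<alpha>)"
    using assms by (intro polydeg_sum polydeg_multc polydeg_lag) auto
  show "u \<beta> = (\<Sum>\<alpha>\<in>A. lag A \<alpha> \<beta> * u \<alpha>)" if "\<beta> \<in> A" for \<beta>
  proof -
    have "(\<Sum>\<alpha>\<in>A. lag A \<alpha> \<beta> * u \<alpha>) = (\<Sum>\<alpha>\<in>A. if \<alpha> = \<beta> then u \<alpha> else 0)"
      using assms that by (intro sum.cong) (auto simp: lag_delta)
    also have "\<dots> = u \<beta>" using assms that by simp
    finally show ?thesis by simp
  qed
qed (use assms in auto)

section \<open>Interpolation in several variables on a product grid\<close>

definition sepdeg :: "nat \<Rightarrow> 'i set \<Rightarrow> (('i \<Rightarrow> 'f::field) \<Rightarrow> 'f) \<Rightarrow> bool" where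
  "sepdeg d J \<phi> \<longleftrightarrow> (\<forall>j\<in>J. \<forall>x. polydeg d (\<lambda>y. \<phi> (x(j := y))))"

lemma sepdegD: "sepdeg d J \<phi> \<Longrightarrow> j \<in> J \<Longrightarrow> polydeg d (\<lambda>y. \<phi> (x(j := y)))"
  by (simp add: sepdeg_def)

text \<open>The tensor-product Lagrange basis of the grid \<open>A ^ J\<close>. It fits
  \<open>sepdeg\<close>, which bounds the degree in each variable and not the total degree.\<close>

definition mlag :: "'f::field set \<Rightarrow> 'i set \<Rightarrow> ('i \<Rightarrow> 'f) \<Rightarrow> ('i \<Rightarrow> 'f) \<Rightarrow> 'f" where
  "mlag A J p x = (\<Prod>j\<in>J. lag A (p j) (x j))"

text \<open>Interpolate one variable at a time: the old ones by induction, the new one by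
  \<open>lag_interp\<close>; the grid splits as a product accordingly.\<close>

lemma mlag_interp:
  assumes "finite J" "finite A" "card A = Suc N" "sepdeg N J \<phi>"
  shows "\<phi> x = (\<Sum>p\<in>PiE J (\<lambda>_. A). mlag A J p x * \<phi> (override_on x p J))"
  using assms(1,4)
proof (induction J rule: finite_induct)
  case empty
  then show ?case by (simp add: mlag_def)
next
  case (insert j J)
  have inj: "inj_on (\<lambda>(y, g). g(j := y)) (A \<times> PiE J (\<lambda>_. A))"
    using insert.hyps inj_combinator[of j J "\<lambda>_. A"] by simp
  have lagj: "mlag A (insert j J) (g(j := \<alpha>)) x = lag A \<alpha> (x j) * mlag A J g x" for \<alpha> g
  proof -
    have "(\<Prod>i\<in>J. lag A ((g(j := \<alpha>)) i) (x i)) = (\<Prod>i\<in>J. lag A (g i) (x i))"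
      by (rule prod.cong) (use insert.hyps in auto)
    then show ?thesis using insert.hyps by (simp add: mlag_def)
  qed
  have ov: "override_on x (g(j := \<alpha>)) (insert j J) = (override_on x g J)(j := \<alpha>)" for \<alpha> g
    using insert.hyps by (auto simp: override_on_def fun_eq_iff)
  have sep: "sepdeg N J \<phi>" using insert.prems by (auto simp: sepdeg_def)
  have "\<phi> x = (\<Sum>g\<in>PiE J (\<lambda>_. A). mlag A J g x * \<phi> (override_on x g J))"
    using insert.IH[OF sep] .
  also have "\<dots> = (\<Sum>g\<in>PiE J (\<lambda>_. A). \<Sum>\<alpha>\<in>A.
      mlag A J g x * (lag A \<alpha> (x j) * \<phi> ((override_on x g J)(j := \<alpha>))))"
  proof (rule sum.cong[OF refl])
    fix g
    have "(override_on x g J)(j := x j) = override_on x g J"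
      using insert.hyps by (auto simp: override_on_def fun_eq_iff)
    moreover have "\<phi> ((override_on x g J)(j := x j)) =
        (\<Sum>\<alpha>\<in>A. lag A \<alpha> (x j) * \<phi> ((override_on x g J)(j := \<alpha>)))"
      by (rule lag_interp[OF assms(2,3) sepdegD[OF insert.prems]]) simp
    ultimately show "mlag A J g x * \<phi> (override_on x g J) = (\<Sum>\<alpha>\<in>A.
      mlag A J g x * (lag A \<alpha> (x j) * \<phi> ((override_on x g J)(j := \<alpha>))))"
      by (simp add: sum_distrib_left)
  qed
  also have "\<dots> = (\<Sum>(\<alpha>, g)\<in>A \<times> PiE J (\<lambda>_. A).
      mlag A J g x * (lag A \<alpha> (x j) * \<phi> ((override_on x g J)(j := \<alpha>))))"
    by (subst sum.swap) (simp add: sum.cartesian_product)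
  also have "\<dots> = (\<Sum>(\<alpha>, g)\<in>A \<times> PiE J (\<lambda>_. A). mlag A (insert j J) (g(j := \<alpha>)) x *
      \<phi> (override_on x (g(j := \<alpha>)) (insert j J)))"
    by (intro sum.cong) (auto simp: lagj ov)
  also have "\<dots> = (\<Sum>p\<in>PiE (insert j J) (\<lambda>_. A). mlag A (insert j J) p x *
      \<phi> (override_on x p (insert j J)))"
    unfolding PiE_insert_eq by (subst sum.reindex[OF inj]) (auto simp: case_prod_unfold)
  finally show ?case .
qed

lemma mlag_delta:
  assumes "finite J" "finite A" "p \<in> PiE J (\<lambda>_. A)" "q \<in> PiE J (\<lambda>_. A)"
  shows "mlag A J p (override_on x q J) = (if p = q then 1 else 0)"
proof (cases "p = q")
  case True
  have "\<And>j. j \<in> J \<Longrightarrow> q j \<in> A" using assms by auto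
  then show ?thesis
    using assms True by (auto simp: mlag_def lag_delta intro!: prod.neutral)
next
  case False
  then obtain j where "j \<in> J" "p j \<noteq> q j"
    using assms by (meson PiE_ext)
  moreover have "p j \<in> A" "q j \<in> A" using \<open>j \<in> J\<close> assms by auto
  ultimately have "\<exists>j\<in>J. lag A (p j) (override_on x q J j) = 0"
    using assms(2) by (intro bexI[of _ j]) (auto simp: lag_delta)
  then show ?thesis using False assms by (simp add: mlag_def)
qed

text \<open>Interpolation of the constant 1. It will show that the vector of all \<open>mlag\<close>
  values at a point is nonzero.\<close>

lemma sum_mlag:
  assumes "finite J" "finite A" "A \<noteq> {}"
  shows "(\<Sum>p\<in>PiE J (\<lambda>_. A). mlag A J p x) = 1"
proof -
  have "card A = Suc (card A - 1)" using assms by (simp add: card_gt_0_iff)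
  then show ?thesis
    using mlag_interp[OF assms(1,2), of "card A - 1" "\<lambda>_. 1" x]
    by (simp add: sepdeg_def polydeg_const)
qed

lemma sepdeg_mlag:
  assumes "finite J" "finite A" "card A = Suc N" "p \<in> PiE J (\<lambda>_. A)"
  shows "sepdeg N J (mlag A J p)"
  unfolding sepdeg_def
proof (intro ballI allI)
  fix j x assume j: "j \<in> J"
  have eq: "mlag A J p (x(j := y)) = lag A (p j) y * mlag A (J - {j}) p x" for y
  proof -
    have "(\<Prod>i\<in>J - {j}. lag A (p i) ((x(j := y)) i)) = (\<Prod>i\<in>J - {j}. lag A (p i) (x i))"
      by (rule prod.cong) auto
    then show ?thesis
      using prod.remove[OF assms(1) j, of "\<lambda>i. lag A (p i) ((x(j := y)) i)"]
      unfolding mlag_def by simp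
  qed
  have "p j \<in> A" using assms j by auto
  then show "polydeg N (\<lambda>y. mlag A J p (x(j := y)))"
    unfolding eq using assms by (intro polydeg_multc polydeg_lag) auto
qed

text \<open>Evaluation at \<open>y\<close> is a ring homomorphism, so the determinant can be formed
  over the polynomial ring, where its degree is bounded.\<close>

lemma polydeg_det:
  assumes "\<And>i j. i < n \<Longrightarrow> j < n \<Longrightarrow> polydeg d (\<lambda>y. B y i j)"
  shows "polydeg (d * n) (\<lambda>y. det (mat n n (\<lambda>(i, j). B y i j)))"
proof -
  obtain P where P: "\<And>i j. i < n \<Longrightarrow> j < n \<Longrightarrow> degree (P i j) \<le> d \<and> (\<lambda>y. B y i j) = poly (P i j)"
    using assms unfolding polydeg_def by metis
  let ?M = "mat n n (\<lambda>(i, j). P i j)"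
  have "det (mat n n (\<lambda>(i, j). B y i j)) = poly (det ?M) y" for y
  proof -
    have h: "comm_ring_hom (\<lambda>p. poly p y)" by unfold_locales auto
    have "mat n n (\<lambda>(i, j). B y i j) = map_mat (\<lambda>p. poly p y) ?M"
      using P by (intro eq_matI) (auto simp: fun_eq_iff)
    then show ?thesis by (simp only: comm_ring_hom.hom_det[OF h])
  qed
  moreover have "degree (det ?M) \<le> d * n" by (rule degree_det_le) (use P in auto)
  ultimately show ?thesis unfolding polydeg_def by (intro exI[of _ "det ?M"]) auto
qed

lemma polydeg_roots:
  assumes "polydeg d u" "u \<alpha> \<noteq> 0"
  shows "finite {y. u y = 0}" "card {y. u y = 0} \<le> d"
proof -
  obtain p where p: "degree p \<le> d" "u = poly p" using assms by (auto simp: polydeg_def)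
  then have nz: "p \<noteq> 0" using assms by auto
  show "finite {y. u y = 0}" using poly_roots_finite[OF nz] p by simp
  show "card {y. u y = 0} \<le> d" using card_poly_roots_bound[OF nz] p by simp
qed

text \<open>The values \<open>- c\<close> are eigenvalues of \<open>B\<close>, hence roots of its
  characteristic polynomial, which has degree \<open>n\<close>.\<close>

lemma det_plus_scalar_roots:
  fixes B :: "'f::field mat"
  assumes "B \<in> carrier_mat n n"
  shows "finite {c. det (B + c \<cdot>\<^sub>m 1\<^sub>m n) = 0}" "card {c. det (B + c \<cdot>\<^sub>m 1\<^sub>m n) = 0} \<le> n"
proof -
  let ?S = "{c. det (B + c \<cdot>\<^sub>m 1\<^sub>m n) = 0}"
  let ?p = "char_poly B"
  have nz: "?p \<noteq> 0" and deg: "degree ?p = n"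
    using degree_monic_char_poly[OF assms] by auto
  have sub: "uminus ` ?S \<subseteq> {x. poly ?p x = 0}"
  proof clarsimp
    fix c assume d: "det (B + c \<cdot>\<^sub>m 1\<^sub>m n) = 0"
    have "eigenvalue B (- c)"
      using d assms unfolding eigenvalue_det[OF assms] char_matrix_def by simp
    then show "poly ?p (- c) = 0" using eigenvalue_root_char_poly[OF assms] by simp
  qed
  have fin: "finite (uminus ` ?S)" using finite_subset[OF sub poly_roots_finite[OF nz]] .
  then show "finite ?S" by (rule finite_imageD) simp
  have "card ?S = card (uminus ` ?S)" by (rule card_image[symmetric]) simp
  also have "\<dots> \<le> card {x. poly ?p x = 0}" by (rule card_mono[OF poly_roots_finite[OF nz] sub])
  also have "\<dots> \<le> n" using card_poly_roots_bound[OF nz] deg by simp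
  finally show "card ?S \<le> n" .
qed

subsection \<open>Elementary symmetric functions of powers\<close>

text \<open>The value is the coefficient of \<open>T ^ i\<close> in the product of the factors \<open>1 + T x\<^sub>j ^ d\<close>
  over \<open>j \<in> js\<close>.  Bihomogenised in every variable, these factors never vanish identically in
  \<open>T\<close>, so the \<open>length js + 1\<close> functions have no common zero even on a product of projective
  lines; \<open>esym_generate\<close> below is the resulting effective Nullstellensatz.\<close>

fun esym :: "nat \<Rightarrow> 'i list \<Rightarrow> nat \<Rightarrow> ('i \<Rightarrow> 'f::field) \<Rightarrow> 'f" where
  "esym d [] i x = (if i = 0 then 1 else 0)"
| "esym d (j # js) i x = esym d js i x + (if i = 0 then 0 else x j ^ d * esym d js (i - 1) x)"

lemma esym_zero: "length js < i \<Longrightarrow> esym d js i x = 0"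
  by (induction js arbitrary: i) auto

lemma esym_cong: "(\<And>j. j \<in> set js \<Longrightarrow> x j = y j) \<Longrightarrow> esym d js i x = esym d js i y"
  by (induction js arbitrary: i) auto

lemma sepdeg_esym:
  "distinct js \<Longrightarrow> sepdeg d (set js) (esym d js i :: ('i \<Rightarrow> 'f::field) \<Rightarrow> 'f)"
proof (induction js arbitrary: i)
  case Nil
  then show ?case by (simp add: sepdeg_def)
next
  case (Cons j js)
  show ?case
    unfolding sepdeg_def
  proof (intro ballI allI)
    fix l and x :: "'i \<Rightarrow> 'f" assume l: "l \<in> set (j # js)"
    show "polydeg d (\<lambda>y. esym d (j # js) i (x(l := y)))"
    proof (cases "l = j")
      case True
      have "esym d js i' (x(j := y)) = esym d js i' x" for i' y
        using Cons.prems by (intro esym_cong) auto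
      then show ?thesis
        using True by (cases "i = 0") (auto intro!: polydeg_add polydeg_const polydeg_multc polydeg_power)
    next
      case False
      then have "polydeg d (\<lambda>y. esym d js i' (x(l := y)))" for i'
        using Cons l by (intro sepdegD) auto
      then show ?thesis
        using False by (cases "i = 0") (auto intro!: polydeg_add polydeg_const polydeg_cmult)
    qed
  qed
qed

text \<open>With \<open>h\<^sub>l = esym d js l\<close>, the bracket is \<open>esym d (j # js) l\<close> and \<open>y\<close> is the value of the
  new variable.  Eliminating from \<open>l = i\<close> downwards costs degree at most \<open>m d\<close> in \<open>y\<close>,
  eliminating upwards divides by powers of \<open>y ^ d\<close>; one of the two is possible for every
  \<open>c \<le> N\<close>.\<close>

lemma esym_step:
  assumes N: "2 * Suc m * d \<le> N" and "c \<le> N" "i \<le> m"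
  shows "\<exists>M. (\<forall>l. polydeg (N - d) (M l)) \<and> (\<forall>h y::'f::field. h (Suc m) = 0 \<longrightarrow>
    y ^ c * h i = (\<Sum>l\<le>Suc m. M l y * (h l + (if l = 0 then 0 else y ^ d * h (l - 1)))))"
proof (cases "Suc m * d \<le> c")
  case True
  define M where "M l y = (if i < l \<and> l \<le> Suc m then (- 1) ^ (l - Suc i) * y ^ (c - d * (l - i)) else 0)"
    for l and y :: 'f
  have "polydeg (N - d) (M l)" for l
  proof (cases "i < l \<and> l \<le> Suc m")
    case True
    then have "d * 1 \<le> d * (l - i)" by (intro mult_le_mono) auto
    then have "d \<le> d * (l - i)" by (simp only: mult_1_right)
    then have "c - d * (l - i) \<le> N - d" using \<open>c \<le> N\<close> by linarith
    then have "polydeg (N - d) (\<lambda>y::'f. (- 1) ^ (l - Suc i) * y ^ (c - d * (l - i)))"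
      by (intro polydeg_cmult polydeg_mono[OF polydeg_power])
    then show ?thesis using True by (simp add: M_def[abs_def])
  next
    case False
    then have "M l = (\<lambda>y. 0)" by (simp only: M_def fun_eq_iff if_False simp_thms)
    then show ?thesis by (simp add: polydeg_const)
  qed
  moreover have "y ^ c * h i = (\<Sum>l\<le>Suc m. M l y * (h l + (if l = 0 then 0 else y ^ d * h (l - 1))))"
    if h: "h (Suc m) = 0" for h and y :: 'f
  proof -
    \<comment> \<open>The summands telescope; the upper end \<open>T (Suc m)\<close> vanishes
      because \<open>h (Suc m) = 0\<close>.\<close>
    define T where "T l = - ((- 1) ^ (l - i) * y ^ (c - d * (l - i)) * h l)" for l
    have "(\<Sum>l\<le>Suc m. M l y * (h l + (if l = 0 then 0 else y ^ d * h (l - 1)))) =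
        (\<Sum>l\<in>{Suc i..Suc m}. M l y * (h l + (if l = 0 then 0 else y ^ d * h (l - 1))))"
      by (rule sum.mono_neutral_right) (auto simp: M_def)
    also have "\<dots> = (\<Sum>l\<in>{Suc i..Suc m}. T l - T (l - 1))"
    proof (rule sum.cong[OF refl])
      fix l assume l: "l \<in> {Suc i..Suc m}"
      then obtain e where e: "l = Suc (i + e)" by (auto dest: le_Suc_ex)
      have "d * Suc e \<le> d * Suc m" using l e by (intro mult_le_mono) auto
      also have "\<dots> \<le> c" using True by (simp add: mult.commute)
      finally have ce: "c - d * e = (c - d * Suc e) + d" by simp
      show "M l y * (h l + (if l = 0 then 0 else y ^ d * h (l - 1))) = T l - T (l - 1)"
        using l by (simp add: e M_def T_def ce power_add algebra_simps del: mult_Suc_right)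
    qed
    also have "\<dots> = T (Suc m) - T i" by (rule sum_telescope'') (use \<open>i \<le> m\<close> in simp)
    also have "\<dots> = y ^ c * h i" using h by (simp add: T_def)
    finally show ?thesis by simp
  qed
  ultimately show ?thesis by blast
next
  case False
  then have cN: "c + Suc m * d \<le> N" using N by simp
  define M where "M l y = (if l \<le> i then (- 1) ^ (i - l) * y ^ (c + d * (i - l)) else 0)"
    for l and y :: 'f
  have "polydeg (N - d) (M l)" for l
  proof (cases "l \<le> i")
    case True
    have "d * (i - l) \<le> d * m" using \<open>i \<le> m\<close> by (intro mult_le_mono) auto
    then have "c + d * (i - l) \<le> N - d" using cN by (simp add: algebra_simps)
    then have "polydeg (N - d) (\<lambda>y::'f. (- 1) ^ (i - l) * y ^ (c + d * (i - l)))"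
      by (intro polydeg_cmult polydeg_mono[OF polydeg_power])
    then show ?thesis using True by (simp add: M_def[abs_def])
  qed (simp add: M_def[abs_def] polydeg_const)
  moreover have "y ^ c * h i = (\<Sum>l\<le>Suc m. M l y * (h l + (if l = 0 then 0 else y ^ d * h (l - 1))))"
    for h and y :: 'f
  proof -
    have "(\<Sum>l\<le>Suc m. M l y * (h l + (if l = 0 then 0 else y ^ d * h (l - 1)))) =
        (\<Sum>l\<le>i. M l y * (h l + (if l = 0 then 0 else y ^ d * h (l - 1))))"
      by (rule sum.mono_neutral_right) (use \<open>i \<le> m\<close> in \<open>auto simp: M_def\<close>)
    also have "\<dots> = y ^ c * (\<Sum>l\<le>i. (- (y ^ d)) ^ (i - l) *
        (h l + (if l = 0 then 0 else y ^ d * h (l - 1))))"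
      unfolding sum_distrib_left
      by (rule sum.cong) (auto simp: M_def power_add power_mult power_minus[of "y ^ d"])
    \<comment> \<open>The alternating sum inverts the recursion that produces the brackets from
      \<open>h\<close>.\<close>
    also have "(\<Sum>l\<le>i. (- (y ^ d)) ^ (i - l) * (h l + (if l = 0 then 0 else y ^ d * h (l - 1)))) = h i"
    proof (induction i)
      case (Suc i)
      have "(\<Sum>l\<le>i. (- (y ^ d)) ^ (Suc i - l) * (h l + (if l = 0 then 0 else y ^ d * h (l - 1)))) =
        - (y ^ d) * (\<Sum>l\<le>i. (- (y ^ d)) ^ (i - l) * (h l + (if l = 0 then 0 else y ^ d * h (l - 1))))"
        unfolding sum_distrib_left by (rule sum.cong) (auto simp: Suc_diff_le)
      then show ?case using Suc.IH by simp
    qed simp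
    finally show ?thesis by simp
  qed
  ultimately show ?thesis by blast
qed

lemma polydeg_monomials:
  assumes "polydeg N u"
  obtains C where "\<And>y. u y = (\<Sum>c\<le>N. C c * y ^ c)"
proof -
  obtain p where p: "degree p \<le> N" "u = poly p" using assms by (auto simp: polydeg_def)
  have "u y = (\<Sum>c\<le>N. coeff p c * y ^ c)" for y
  proof -
    have "u y = (\<Sum>c\<le>degree p. coeff p c * y ^ c)" using p by (simp add: poly_altdef)
    also have "\<dots> = (\<Sum>c\<le>N. coeff p c * y ^ c)"
      using p by (intro sum.mono_neutral_left) (auto simp: coeff_eq_0)
    finally show ?thesis .
  qed
  then show thesis by (rule that)
qed

text \<open>Induction on the variables: expand \<open>\<phi>\<close> in powers of the new variable,
  represent each coefficient by induction, and absorb the powers with \<open>esym_step\<close>.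
  Since the cofactors have degree at most \<open>N - d\<close>, replacing the \<open>esym\<close>
  factors by other functions of degree \<open>d\<close> stays within degree
  \<open>N\<close>.\<close>

lemma esym_generate:
  fixes \<phi> :: "('i \<Rightarrow> 'f::field) \<Rightarrow> 'f" and A :: "'f set"
  assumes "distinct js" "2 * length js * d \<le> N" "finite A" "card A = Suc N" "sepdeg N (set js) \<phi>"
  shows "\<exists>r. (\<forall>i. sepdeg (N - d) (set js) (r i)) \<and>
    (\<forall>x. \<phi> x = (\<Sum>i\<le>length js. esym d js i x * r i x))"
  using assms(1,2,5)
proof (induction js arbitrary: \<phi>)
  case Nil
  show ?case by (rule exI[of _ "\<lambda>i x. \<phi> x"]) (simp add: sepdeg_def)
next
  case (Cons j js)
  let ?m = "length js"
  have "\<exists>C. \<forall>y. lag A \<alpha> y = (\<Sum>c\<le>N. C c * y ^ c)" if "\<alpha> \<in> A" for \<alpha>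
    by (rule polydeg_monomials[OF polydeg_lag[OF assms(3) that, of N]]) (use assms(4) in auto)
  then obtain C where C: "\<And>\<alpha> y. \<alpha> \<in> A \<Longrightarrow> lag A \<alpha> y = (\<Sum>c\<le>N. C \<alpha> c * y ^ c)"
    by metis
  \<comment> \<open>\<open>\<phi>' c\<close> is the coefficient of \<open>x j ^ c\<close> in
    \<open>\<phi>\<close>. Written through the slices \<open>x j = \<alpha>\<close>, it inherits the
    degree bounds in the other variables.\<close>
  define \<phi>' where "\<phi>' c x = (\<Sum>\<alpha>\<in>A. C \<alpha> c * \<phi> (x(j := \<alpha>)))" for c x
  have exp: "\<phi> x = (\<Sum>c\<le>N. x j ^ c * \<phi>' c x)" for x
  proof -
    have "\<phi> x = \<phi> (x(j := x j))" by simp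
    also have "\<dots> = (\<Sum>\<alpha>\<in>A. lag A \<alpha> (x j) * \<phi> (x(j := \<alpha>)))"
      by (rule lag_interp[OF assms(3,4) sepdegD[OF Cons.prems(3)]]) simp
    also have "\<dots> = (\<Sum>\<alpha>\<in>A. \<Sum>c\<le>N. x j ^ c * (C \<alpha> c * \<phi> (x(j := \<alpha>))))"
      by (intro sum.cong) (simp_all add: C sum_distrib_left sum_distrib_right mult_ac)
    also have "\<dots> = (\<Sum>c\<le>N. x j ^ c * \<phi>' c x)"
      by (subst sum.swap) (simp add: \<phi>'_def sum_distrib_left)
    finally show ?thesis .
  qed
  have sep': "sepdeg N (set js) (\<phi>' c)" for c
    unfolding sepdeg_def
  proof (intro ballI allI)
    fix l x assume l: "l \<in> set js"
    then have "j \<noteq> l" using Cons.prems(1) by auto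
    moreover have "polydeg N (\<lambda>y. \<phi> (x(j := \<alpha>, l := y)))" for \<alpha>
      by (rule sepdegD[OF Cons.prems(3)]) (use l in auto)
    ultimately show "polydeg N (\<lambda>y. \<phi>' c (x(l := y)))"
      unfolding \<phi>'_def by (auto simp: fun_upd_twist intro!: polydeg_sum polydeg_cmult)
  qed
  have "\<exists>r. (\<forall>i. sepdeg (N - d) (set js) (r i)) \<and>
      (\<forall>x. \<phi>' c x = (\<Sum>i\<le>?m. esym d js i x * r i x))" for c
    by (rule Cons.IH) (use Cons.prems sep' in auto)
  then obtain r where r: "\<And>c i. sepdeg (N - d) (set js) (r c i)"
    "\<And>c x. \<phi>' c x = (\<Sum>i\<le>?m. esym d js i x * r c i x)"
    by metis
  \<comment> \<open>The multipliers serve all \<open>h\<close> and \<open>y\<close> at once, so they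
    contribute no degree in the variables of \<open>js\<close>.\<close>
  define Q where "Q c i M \<longleftrightarrow> (\<forall>l. polydeg (N - d) (M l)) \<and> (\<forall>h y::'f. h (Suc ?m) = 0 \<longrightarrow>
      y ^ c * h i = (\<Sum>l\<le>Suc ?m. M l y * (h l + (if l = 0 then 0 else y ^ d * h (l - 1)))))"
    for c i M
  define M where "M c i = (SOME M. Q c i M)" for c i
  have ex: "\<exists>M. Q c i M" if "c \<le> N" "i \<le> ?m" for c i
    unfolding Q_def by (rule esym_step) (use that Cons.prems in auto)
  have Q: "Q c i (M c i)" if "c \<le> N" "i \<le> ?m" for c i
    unfolding M_def by (rule someI_ex[OF ex[OF that]])
  have M1: "polydeg (N - d) (M c i l)" if "c \<le> N" "i \<le> ?m" for c i l
    using Q[OF that] unfolding Q_def by (elim conjE) (erule spec)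
  have M2: "y ^ c * h i =
      (\<Sum>l\<le>Suc ?m. M c i l y * (h l + (if l = 0 then 0 else y ^ d * h (l - 1))))"
    if "c \<le> N" "i \<le> ?m" "h (Suc ?m) = 0" for c i h y
    using Q[OF that(1,2)] that(3) unfolding Q_def by (elim conjE allE[of _ h] allE[of _ y] impE)
  \<comment> \<open>Setting \<open>x j\<close> to 0 inside \<open>r\<close> leaves the degree in
    \<open>x j\<close> to \<open>M\<close> alone; the coefficients \<open>\<phi>' c\<close> do not
    change under it.\<close>
  define R where "R l x = (\<Sum>c\<le>N. \<Sum>i\<le>?m. r c i (x(j := 0)) * M c i l (x j))" for l x
  have "sepdeg (N - d) (set (j # js)) (R l)" for l
    unfolding sepdeg_def
  proof (intro ballI allI)
    fix l' x assume l': "l' \<in> set (j # js)"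
    show "polydeg (N - d) (\<lambda>y. R l (x(l' := y)))"
    proof (cases "l' = j")
      case True
      show ?thesis
        unfolding R_def True fun_upd_upd fun_upd_same
      proof (rule polydeg_sum, rule polydeg_sum)
        fix c i assume "c \<in> {..N}" "i \<in> {..?m}"
        then show "polydeg (N - d) (\<lambda>y. r c i (x(j := 0)) * M c i l y)"
          by (intro polydeg_cmult M1) auto
      qed
    next
      case False
      have p: "polydeg (N - d) (\<lambda>y. r c i ((x(j := 0))(l' := y)))" for c i
        using l' False by (intro sepdegD[OF r(1)]) auto
      have "polydeg (N - d)
          (\<lambda>y. \<Sum>c\<le>N. \<Sum>i\<le>?m. r c i ((x(j := 0))(l' := y)) * M c i l (x j))"
        by (rule polydeg_sum, rule polydeg_sum, rule polydeg_multc, rule p)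
      moreover have "R l (x(l' := y)) =
          (\<Sum>c\<le>N. \<Sum>i\<le>?m. r c i ((x(j := 0))(l' := y)) * M c i l (x j))" for y
        using False fun_upd_twist[of l' j x y 0] by (simp add: R_def)
      ultimately show ?thesis by (simp only:)
    qed
  qed
  moreover have "\<phi> x = (\<Sum>l\<le>length (j # js). esym d (j # js) l x * R l x)" for x
  proof -
    have "\<phi>' c x = (\<Sum>i\<le>?m. esym d js i x * r c i (x(j := 0)))" for c
    proof -
      have "\<phi>' c x = \<phi>' c (x(j := 0))" by (simp add: \<phi>'_def)
      moreover have "esym d js i (x(j := 0)) = esym d js i x" for i
        by (rule esym_cong) (use Cons.prems in auto)
      ultimately show ?thesis by (simp add: r(2))
    qed
    then have "\<phi> x = (\<Sum>c\<le>N. \<Sum>i\<le>?m. r c i (x(j := 0)) * (x j ^ c * esym d js i x))"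
      by (subst exp) (simp add: sum_distrib_left algebra_simps)
    also have "\<dots> = (\<Sum>c\<le>N. \<Sum>i\<le>?m. r c i (x(j := 0)) *
        (\<Sum>l\<le>Suc ?m. M c i l (x j) * esym d (j # js) l x))"
    proof (intro sum.cong refl arg_cong2[where f = "(*)"])
      fix c i assume "c \<in> {..N}" "i \<in> {..?m}"
      then show "x j ^ c * esym d js i x = (\<Sum>l\<le>Suc ?m. M c i l (x j) * esym d (j # js) l x)"
        using M2[of c i "\<lambda>i. esym d js i x" "x j"] by (simp add: esym_zero)
    qed
    also have "\<dots> = (\<Sum>c\<le>N. \<Sum>i\<le>?m. \<Sum>l\<le>Suc ?m.
        esym d (j # js) l x * (r c i (x(j := 0)) * M c i l (x j)))"
      unfolding sum_distrib_left
      by (intro sum.cong refl) (simp add: ac_simps)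
    also have "\<dots> = (\<Sum>c\<le>N. \<Sum>l\<le>Suc ?m. \<Sum>i\<le>?m.
        esym d (j # js) l x * (r c i (x(j := 0)) * M c i l (x j)))"
      by (intro sum.cong refl sum.swap)
    also have "\<dots> = (\<Sum>l\<le>Suc ?m. \<Sum>c\<le>N. \<Sum>i\<le>?m.
        esym d (j # js) l x * (r c i (x(j := 0)) * M c i l (x j)))"
      by (rule sum.swap)
    also have "\<dots> = (\<Sum>l\<le>length (j # js). esym d (j # js) l x * R l x)"
      by (simp only: R_def sum_distrib_left length_Cons)
    finally show ?thesis .
  qed
  ultimately show ?case by blast
qed

subsection \<open>Zeros of perturbed systems of polynomials\<close>

text \<open>\<open>S c\<close> is the projection to coordinate \<open>j\<close> of the common zeros of the perturbed system
  \<open>G c\<close>.  Expressing the Lagrange basis of a grid through \<open>esym\<close> and substituting \<open>G c\<close> for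
  \<open>esym\<close> gives a square matrix \<open>B (G c) \<beta>\<close> which is singular when \<open>\<beta> \<in> S c\<close> and whose
  determinant is a polynomial in \<open>\<beta>\<close>.  At a node \<open>\<tau> \<in> T\<close> the perturbation adds \<open>c \<tau>\<close>
  times the identity matrix, so the determinant vanishes at \<open>\<tau>\<close> for few \<open>c \<tau>\<close> only.\<close>

lemma fibre_bound:
  fixes js :: "'i list" and g :: "nat \<Rightarrow> ('i \<Rightarrow> 'f::field) \<Rightarrow> 'f" and A T :: "'f set" and z0
  assumes dist: "distinct (j # js)" and N: "2 * length js * d \<le> N"
    and A: "finite A" "card A = Suc N" and T: "finite T" "card T \<le> Suc d"
    and g: "\<And>i. i \<le> length js \<Longrightarrow> sepdeg d (set (j # js)) (g i)"
  defines "G \<equiv> \<lambda>c i x. g i x + (\<Sum>\<tau>\<in>T. c \<tau> * lag T \<tau> (x j) * esym d js i x)"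
  defines "S \<equiv> \<lambda>c. {z j |z. (\<forall>l. l \<notin> set (j # js) \<longrightarrow> z l = z0 l) \<and> (\<forall>i\<le>length js. G c i z = 0)}"
  shows "\<exists>R. (\<forall>\<tau>\<in>T. finite (R \<tau>) \<and> card (R \<tau>) \<le> Suc N ^ length js) \<and>
    (\<forall>c. (\<exists>\<tau>\<in>T. c \<tau> \<notin> R \<tau>) \<longrightarrow> finite (S c) \<and> card (S c) \<le> d * Suc N ^ length js)"
proof -
  define J where "J = set js"
  define m where "m = length js"
  define P where "P = PiE J (\<lambda>_. A)"
  define n where "n = Suc N ^ length js"
  have J: "finite J" "j \<notin> J" "card J = length js"
    using dist distinct_card by (auto simp: J_def)
  have P: "finite P" "card P = n"
    using J A by (auto simp: P_def n_def card_funcsetE intro: finite_PiE)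
  obtain e where e: "bij_betw e {0..<n} P"
    using ex_bij_betw_nat_finite[OF P(1)] P(2) by auto
  have eP: "e a \<in> P" if "a < n" for a using e that by (auto simp: bij_betw_def)
  have "\<exists>r. (\<forall>i. sepdeg (N - d) J (r i)) \<and>
      (\<forall>x. mlag A J p x = (\<Sum>i\<le>m. esym d js i x * r i x))" if "p \<in> P" for p
    unfolding J_def m_def
    by (rule esym_generate[OF _ N A])
      (use dist that J A sepdeg_mlag[of J A N p] in \<open>auto simp: P_def J_def\<close>)
  then obtain r where r: "\<And>p i. p \<in> P \<Longrightarrow> sepdeg (N - d) J (r p i)"
    "\<And>p x. p \<in> P \<Longrightarrow> mlag A J p x = (\<Sum>i\<le>m. esym d js i x * r p i x)"
    by metis
  \<comment> \<open>Freezing \<open>x j\<close> makes the cofactors constant in the slice parameter,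
    which then enters the matrix \<open>B\<close> only through \<open>u\<close>.\<close>
  define r' where "r' p i x = r p i (x(j := 0))" for p i x
  have esym_j: "esym d js i (x(j := y)) = esym d js i x" for i y and x :: "'i \<Rightarrow> 'f"
    by (rule esym_cong) (use dist in auto)
  have r'_sep: "sepdeg (N - d) J (r' p i)" if "p \<in> P" for p i
    unfolding sepdeg_def r'_def
  proof (intro ballI allI)
    fix l x assume l: "l \<in> J"
    then have "l \<noteq> j" using J by auto
    then show "polydeg (N - d) (\<lambda>y. r p i (x(l := y, j := 0)))"
      using sepdegD[OF r(1)[OF that] l, of i "x(j := 0)"] by (simp add: fun_upd_twist)
  qed
  have r'_eq: "mlag A J p x = (\<Sum>i\<le>m. esym d js i x * r' p i x)" if "p \<in> P" for p x
  proof -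
    have "mlag A J p x = mlag A J p (x(j := 0))"
      unfolding mlag_def by (rule prod.cong) (use J in auto)
    then show ?thesis using r(2)[OF that, of "x(j := 0)"] by (simp add: r'_def esym_j)
  qed
  define pt where "pt \<beta> p = (override_on z0 p J)(j := \<beta>)" for \<beta> and p :: "'i \<Rightarrow> 'f"
  \<comment> \<open>Rows are grid points of the slice, columns are members of the Lagrange basis.
    With \<open>u = esym d js\<close> this is the identity matrix, by
    \<open>mlag_pt\<close>.\<close>
  define B where "B u \<beta> = mat n n (\<lambda>(a, b). \<Sum>i\<le>m. u i (pt \<beta> (e a)) * r' (e b) i (pt \<beta> (e a)))"
    for u :: "nat \<Rightarrow> ('i \<Rightarrow> 'f) \<Rightarrow> 'f" and \<beta>
  have Bc: "B u \<beta> \<in> carrier_mat n n" for u \<beta> by (simp add: B_def)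
  have mlag_pt: "(\<Sum>i\<le>m. esym d js i (pt \<beta> (e a)) * r' (e b) i (pt \<beta> (e a))) = (if a = b then 1 else 0)"
    if "a < n" "b < n" for \<beta> a b
  proof -
    have "pt \<beta> (e a) = override_on (z0(j := \<beta>)) (e a) J"
      using J by (auto simp: pt_def override_on_def fun_eq_iff)
    then have "mlag A J (e b) (pt \<beta> (e a)) = (if e b = e a then 1 else 0)"
      using eP that J A by (simp add: P_def mlag_delta)
    moreover have "e b = e a \<longleftrightarrow> a = b"
      using e that by (auto simp: bij_betw_def inj_on_def)
    ultimately show ?thesis using r'_eq[OF eP[OF that(2)]] by metis
  qed
  \<comment> \<open>At a node \<open>\<tau>\<close> the Lagrange factors of all other nodes vanish,
    so only \<open>c \<tau>\<close> is seen.\<close>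
  have slice: "B (G c) \<tau> = B g \<tau> + c \<tau> \<cdot>\<^sub>m 1\<^sub>m n" if "\<tau> \<in> T" for c \<tau>
  proof (rule eq_matI)
    fix a b assume "a < dim_row (B g \<tau> + c \<tau> \<cdot>\<^sub>m 1\<^sub>m n)" "b < dim_col (B g \<tau> + c \<tau> \<cdot>\<^sub>m 1\<^sub>m n)"
    then have ab: "a < n" "b < n" by (auto simp: B_def)
    let ?x = "pt \<tau> (e a)"
    have "(\<Sum>\<sigma>\<in>T. c \<sigma> * lag T \<sigma> (?x j) * esym d js i ?x) =
        (\<Sum>\<sigma>\<in>T. if \<sigma> = \<tau> then c \<sigma> * esym d js i ?x else 0)" for i
      using T that by (intro sum.cong) (auto simp: pt_def lag_delta)
    then have "G c i ?x = g i ?x + c \<tau> * esym d js i ?x" for i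
      using T that by (simp add: G_def)
    then have "(\<Sum>i\<le>m. G c i ?x * r' (e b) i ?x) =
        (\<Sum>i\<le>m. g i ?x * r' (e b) i ?x) + c \<tau> * (\<Sum>i\<le>m. esym d js i ?x * r' (e b) i ?x)"
      by (simp add: algebra_simps sum.distrib sum_distrib_left)
    then show "B (G c) \<tau> $$ (a, b) = (B g \<tau> + c \<tau> \<cdot>\<^sub>m 1\<^sub>m n) $$ (a, b)"
      using ab by (simp add: B_def mlag_pt)
  qed (auto simp: B_def)
  have Gsep: "sepdeg d (set (j # js)) (G c i)" if "i \<le> m" for c i
    unfolding sepdeg_def
  proof (intro ballI allI)
    fix l and x :: "'i \<Rightarrow> 'f" assume l: "l \<in> set (j # js)"
    have g': "polydeg d (\<lambda>y. g i (x(l := y)))"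
      by (rule sepdegD[OF g l]) (use that in \<open>simp add: m_def\<close>)
    show "polydeg d (\<lambda>y. G c i (x(l := y)))"
    proof (cases "l = j")
      case True
      have "polydeg d (\<lambda>y. c \<tau> * lag T \<tau> y * esym d js i x)" if "\<tau> \<in> T" for \<tau>
        by (intro polydeg_multc polydeg_cmult polydeg_lag[OF T(1) that T(2)])
      then show ?thesis
        unfolding G_def using g' True by (intro polydeg_add polydeg_sum) (simp_all add: esym_j)
    next
      case False
      then have "polydeg d (\<lambda>y. esym d js i (x(l := y)))"
        using sepdeg_esym[of js d i] dist l by (auto intro: sepdegD)
      then show ?thesis
        unfolding G_def using g' False by (intro polydeg_add polydeg_sum) (simp_all add: polydeg_cmult)
    qed
  qed
  have sing: "det (B (G c) (z j)) = 0"
    if z: "\<forall>l. l \<notin> set (j # js) \<longrightarrow> z l = z0 l" "\<forall>i\<le>length js. G c i z = 0" for c z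
  proof -
    let ?B = "B (G c) (z j)"
    \<comment> \<open>The Lagrange values at \<open>z\<close> form a kernel vector of the transpose:
      column \<open>b\<close> lists the grid values of a function \<open>\<chi>\<close> that
      vanishes at \<open>z\<close>, and interpolation writes \<open>\<chi> z\<close> as their
      combination with these coefficients.\<close>
    define v where "v = vec n (\<lambda>a. mlag A J (e a) z)"
    have ov: "override_on z p J = pt (z j) p" for p
      using z(1) J by (auto simp: pt_def override_on_def J_def fun_eq_iff)
    have "?B\<^sup>T *\<^sub>v v = 0\<^sub>v n"
    proof (rule eq_vecI)
      fix b assume "b < dim_vec (0\<^sub>v n)"
      then have b: "b < n" by simp
      define \<chi> where "\<chi> x = (\<Sum>i\<le>m. G c i x * r' (e b) i x)" for x
      have "sepdeg N J \<chi>"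
        unfolding sepdeg_def \<chi>_def
      proof (intro ballI allI polydeg_sum)
        fix l x i assume l: "l \<in> J" and i: "i \<in> {..m}"
        \<comment> \<open>Truncated subtraction asks for \<open>d \<le> N\<close>: as
          \<open>l\<close> lies in \<open>J\<close>, \<open>js\<close> is nonempty and the bound on
          \<open>N\<close> applies.\<close>
        have dN: "d + (N - d) \<le> N"
        proof -
          have "js \<noteq> []" using l by (auto simp: J_def)
          then have "1 * d \<le> 2 * length js * d" by (intro mult_le_mono) (cases js; simp)+
          then have "d \<le> 2 * length js * d" by (simp only: mult_1)
          then show ?thesis using N by linarith
        qed
        show "polydeg N (\<lambda>y. G c i (x(l := y)) * r' (e b) i (x(l := y)))"
          by (rule polydeg_mult[OF sepdegD[OF Gsep] sepdegD[OF r'_sep[OF eP[OF b]] l] dN])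
            (use l i in \<open>auto simp: J_def\<close>)
      qed
      then have "\<chi> z = (\<Sum>p\<in>P. mlag A J p z * \<chi> (pt (z j) p))"
        using mlag_interp[OF J(1) A, of \<chi> z] by (simp add: P_def ov)
      also have "\<dots> = (\<Sum>a\<in>{0..<n}. mlag A J (e a) z * \<chi> (pt (z j) (e a)))"
        by (rule sum.reindex_bij_betw[OF e, symmetric])
      also have "\<dots> = (?B\<^sup>T *\<^sub>v v) $ b"
        using b by (simp add: B_def v_def scalar_prod_def \<chi>_def mult.commute)
      finally have "(?B\<^sup>T *\<^sub>v v) $ b = \<chi> z" by simp
      also have "\<chi> z = 0" using z(2) by (simp add: \<chi>_def m_def)
      finally show "(?B\<^sup>T *\<^sub>v v) $ b = 0\<^sub>v n $ b" using b by simp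
    qed (simp add: B_def)
    moreover have "v \<noteq> 0\<^sub>v n"
    proof
      assume v0: "v = 0\<^sub>v n"
      have "mlag A J (e a) z = 0" if "a < n" for a
        using arg_cong[OF v0, of "\<lambda>w. vec_index w a"] that by (simp add: v_def)
      then have "(\<Sum>a\<in>{0..<n}. mlag A J (e a) z) = 0" by simp
      moreover have "(\<Sum>a\<in>{0..<n}. mlag A J (e a) z) = (\<Sum>p\<in>P. mlag A J p z)"
        by (rule sum.reindex_bij_betw[OF e])
      moreover have "(\<Sum>p\<in>P. mlag A J p z) = 1"
        unfolding P_def by (rule sum_mlag) (use J A in auto)
      ultimately show False by simp
    qed
    ultimately have "det (?B\<^sup>T) = 0"
      using det_0_iff_vec_prod_zero_field[OF transpose_carrier_mat[THEN iffD2, OF Bc]]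
      by (metis v_def vec_carrier)
    then show ?thesis using det_transpose[OF Bc] by metis
  qed
  \<comment> \<open>These sets do not depend on \<open>c\<close>, so a \<open>c\<close> that fails
    at every node lies in their product.\<close>
  define R where "R \<tau> = {x. det (B g \<tau> + x \<cdot>\<^sub>m 1\<^sub>m n) = 0}" for \<tau>
  have "finite (S c) \<and> card (S c) \<le> d * n" if \<tau>: "\<tau> \<in> T" "c \<tau> \<notin> R \<tau>" for c \<tau>
  proof -
    have "polydeg (d * n) (\<lambda>\<beta>. det (B (G c) \<beta>))"
      unfolding B_def
    proof (rule polydeg_det[where B = "\<lambda>\<beta> a b. \<Sum>i\<le>m. G c i (pt \<beta> (e a)) * r' (e b) i (pt \<beta> (e a))"],
        rule polydeg_sum)
      fix a b i assume "a < n" "b < n" "i \<in> {..m}"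
      then have "polydeg d (\<lambda>\<beta>. G c i (pt \<beta> (e a)))"
        unfolding pt_def by (intro sepdegD[OF Gsep]) auto
      then have "polydeg d (\<lambda>\<beta>. G c i (pt \<beta> (e a)) * r' (e b) i (pt 0 (e a)))"
        by (rule polydeg_multc)
      then show "polydeg d (\<lambda>\<beta>. G c i (pt \<beta> (e a)) * r' (e b) i (pt \<beta> (e a)))"
        by (simp add: r'_def pt_def)
    qed
    moreover have "det (B (G c) \<tau>) \<noteq> 0" using \<tau> by (simp add: slice R_def)
    ultimately have roots: "finite {\<beta>. det (B (G c) \<beta>) = 0}" "card {\<beta>. det (B (G c) \<beta>) = 0} \<le> d * n"
      by (rule polydeg_roots)+
    have sub: "S c \<subseteq> {\<beta>. det (B (G c) \<beta>) = 0}"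
      using sing by (auto simp: S_def)
    show ?thesis using finite_subset[OF sub roots(1)] card_mono[OF roots(1) sub] roots(2) by simp
  qed
  moreover have "finite (R \<tau>) \<and> card (R \<tau>) \<le> n" for \<tau>
    unfolding R_def using det_plus_scalar_roots[OF Bc] by blast
  ultimately show ?thesis unfolding n_def by blast
qed

subsection \<open>Random polynomials\<close>

text \<open>Double counting: each translation \<open>T c\<close> permutes the finite set
  \<open>F\<close>.\<close>

lemma sum_card_shift:
  assumes "finite F" "finite L"
    and T: "\<And>c. c \<in> L \<Longrightarrow> inj_on (T c) F" "\<And>c \<phi>. c \<in> L \<Longrightarrow> \<phi> \<in> F \<Longrightarrow> T c \<phi> \<in> F"
  shows "(\<Sum>\<phi>\<in>F. card {c \<in> L. T c \<phi> \<in> B}) = card L * card (F \<inter> B)"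
proof -
  have "(\<Sum>\<phi>\<in>F. card {c \<in> L. T c \<phi> \<in> B}) = (\<Sum>c\<in>L. card (F \<inter> B))"
  proof (rule sum_multicount_gen[OF assms(1,2)], rule ballI)
    fix c assume c: "c \<in> L"
    have "T c ` F = F"
      by (rule endo_inj_surj[OF assms(1) _ T(1)[OF c]]) (use T(2) c in auto)
    then have "T c ` {\<phi> \<in> F. T c \<phi> \<in> B} = F \<inter> B" by auto
    moreover have "inj_on (T c) {\<phi> \<in> F. T c \<phi> \<in> B}"
      using T(1)[OF c] by (rule inj_on_subset) auto
    ultimately show "card {\<phi> \<in> F. T c \<phi> \<in> B} = card (F \<inter> B)"
      using card_image by metis
  qed
  then show ?thesis by simp
qed

text \<open>A random translate of a random \<open>\<phi>\<close> is again uniform on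
  \<open>F\<close>, so a bound \<open>b / card L\<close> for every fixed \<open>\<phi>\<close>
  bounds the density of \<open>B\<close>.\<close>

lemma shift_count_le:
  assumes "finite F" "finite L"
    and "\<And>c. c \<in> L \<Longrightarrow> inj_on (T c) F" "\<And>c \<phi>. c \<in> L \<Longrightarrow> \<phi> \<in> F \<Longrightarrow> T c \<phi> \<in> F"
    and "\<And>\<phi>. \<phi> \<in> F \<Longrightarrow> card {c \<in> L. T c \<phi> \<in> B} \<le> b"
  shows "card L * card (F \<inter> B) \<le> b * card F"
proof -
  have "card L * card (F \<inter> B) = (\<Sum>\<phi>\<in>F. card {c \<in> L. T c \<phi> \<in> B})"
    by (rule sum_card_shift[OF assms(1-4), symmetric])
  also have "\<dots> \<le> (\<Sum>\<phi>\<in>F. b)" by (intro sum_mono assms)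
  finally show ?thesis by (simp add: mult.commute)
qed

text \<open>The dual estimate: one good translation per \<open>\<phi>\<close> makes the density of
  \<open>B\<close> at least \<open>1 / card L\<close>.\<close>

lemma shift_count_ge:
  assumes "finite F" "finite L"
    and "\<And>c. c \<in> L \<Longrightarrow> inj_on (T c) F" "\<And>c \<phi>. c \<in> L \<Longrightarrow> \<phi> \<in> F \<Longrightarrow> T c \<phi> \<in> F"
    and "\<And>\<phi>. \<phi> \<in> F \<Longrightarrow> \<exists>c\<in>L. T c \<phi> \<in> B"
  shows "card F \<le> card L * card (F \<inter> B)"
proof -
  have "card F = (\<Sum>\<phi>\<in>F. 1)" by simp
  also have "\<dots> \<le> (\<Sum>\<phi>\<in>F. card {c \<in> L. T c \<phi> \<in> B})"
  proof (rule sum_mono)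
    fix \<phi> assume "\<phi> \<in> F"
    then have "{c \<in> L. T c \<phi> \<in> B} \<noteq> {}" using assms(5) by auto
    moreover have "finite {c \<in> L. T c \<phi> \<in> B}" using assms(2) by simp
    ultimately have "0 < card {c \<in> L. T c \<phi> \<in> B}" by (simp add: card_gt_0_iff)
    then show "1 \<le> card {c \<in> L. T c \<phi> \<in> B}" by simp
  qed
  also have "\<dots> = card L * card (F \<inter> B)" by (rule sum_card_shift[OF assms(1-4)])
  finally show ?thesis .
qed

definition plug :: "'a \<Rightarrow> ('a \<times> nat \<Rightarrow> 'f) \<Rightarrow> (nat \<Rightarrow> 'f) \<Rightarrow> 'a \<times> nat \<Rightarrow> 'f" where
  "plug w Y x = (\<lambda>(c, l). if c = w then x l else Y (c, l))"

text \<open>The finite field is a subset of a larger field, so that its size can vary within one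
  type. The inequality \<open>k \<le> Suc d\<close> leaves room for the at most \<open>k - 1\<close>
  linear factors of \<open>Lc\<close> in \<open>config_bound\<close>.\<close>

locale random_polynomials =
  fixes K :: "'f::field set" and V :: "'a set" and E :: "'a set set" and k d :: nat
  assumes finK: "finite K" and K0: "0 \<in> K" and K1: "1 \<in> K"
    and Kadd: "x \<in> K \<Longrightarrow> y \<in> K \<Longrightarrow> x + y \<in> K"
    and Kmult: "x \<in> K \<Longrightarrow> y \<in> K \<Longrightarrow> x * y \<in> K"
    and Kuminus: "x \<in> K \<Longrightarrow> - x \<in> K"
    and Kinverse: "x \<in> K \<Longrightarrow> inverse x \<in> K"
    and finV: "finite V" and EV: "E \<subseteq> Pow V" and kd: "k \<le> Suc d"
begin

lemma Kdiff: "x \<in> K \<Longrightarrow> y \<in> K \<Longrightarrow> x - y \<in> K"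
  using Kadd[of x "- y"] Kuminus by simp

lemma Kdivide: "x \<in> K \<Longrightarrow> y \<in> K \<Longrightarrow> x / y \<in> K"
  by (simp add: divide_inverse Kmult Kinverse)

lemma Ksum: "(\<And>i. i \<in> I \<Longrightarrow> u i \<in> K) \<Longrightarrow> (\<Sum>i\<in>I. u i) \<in> K"
  by (induction I rule: infinite_finite_induct) (auto simp: K0 Kadd)

lemma Kprod: "(\<And>i. i \<in> I \<Longrightarrow> u i \<in> K) \<Longrightarrow> (\<Prod>i\<in>I. u i) \<in> K"
  by (induction I rule: infinite_finite_induct) (auto simp: K1 Kmult)

lemma Kpower: "x \<in> K \<Longrightarrow> x ^ n \<in> K"
  by (induction n) (auto simp: K1 Kmult)

lemma Kesym: "(\<And>l. l \<in> set js \<Longrightarrow> x l \<in> K) \<Longrightarrow> esym d' js i x \<in> K"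
  by (induction js arbitrary: i) (auto simp: K0 K1 intro!: Kadd Kmult Kpower)

lemma Klag: "T \<subseteq> K \<Longrightarrow> \<tau> \<in> T \<Longrightarrow> y \<in> K \<Longrightarrow> lag T \<tau> y \<in> K"
  unfolding lag_def by (intro Kprod Kdivide Kdiff) auto

definition coords :: "'a set \<Rightarrow> ('a \<times> nat) set" where
  "coords e = e \<times> {..<k}"

definition pts :: "'a set \<Rightarrow> ('a \<times> nat \<Rightarrow> 'f) set" where
  "pts e = PiE (coords e) (\<lambda>_. K)"

definition slots :: "('a set \<times> ('a \<times> nat \<Rightarrow> 'f)) set" where
  "slots = Sigma E pts"

text \<open>A slot \<open>(e, Z)\<close> is a potential edge of the host: one vertex of colour \<open>w\<close> and position
  \<open>\<lambda>l. Z (w, l)\<close> for every \<open>w \<in> e\<close>.  The random polynomials are kept as \<open>K\<close>-valued functions on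
  the slots, extended by \<open>0\<close>; the polynomial \<open>\<psi>\<close> inducing such a function need not have
  coefficients in \<open>K\<close>.\<close>

definition polys :: "('a set \<times> ('a \<times> nat \<Rightarrow> 'f) \<Rightarrow> 'f) set" where
  "polys = {\<phi>. (\<forall>P. (P \<in> slots \<longrightarrow> \<phi> P \<in> K) \<and> (P \<notin> slots \<longrightarrow> \<phi> P = 0)) \<and>
    (\<exists>\<psi>. (\<forall>e\<in>E. sepdeg d (coords e) (\<psi> e)) \<and> (\<forall>e Z. (e, Z) \<in> slots \<longrightarrow> \<phi> (e, Z) = \<psi> e Z))}"

lemma polysD:
  assumes "\<phi> \<in> polys"
  shows "P \<in> slots \<Longrightarrow> \<phi> P \<in> K" "P \<notin> slots \<Longrightarrow> \<phi> P = 0"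
  using assms unfolding polys_def by blast+

lemma finE: "finite E" and fin_edge: "e \<in> E \<Longrightarrow> finite e"
  using finite_subset[OF EV] EV finV by (auto intro: finite_subset)

lemma finite_slots: "finite slots"
  unfolding slots_def pts_def coords_def
  by (intro finite_SigmaI finite_PiE finE) (auto simp: fin_edge finK)

lemma finite_polys: "finite polys"
  by (rule finite_subset[OF _ finite_set_of_finite_funs[OF finite_slots finK, of 0]])
    (auto simp: polys_def)

definition shift :: "('a set \<Rightarrow> ('a \<times> nat \<Rightarrow> 'f) \<Rightarrow> 'f) \<Rightarrow> ('a set \<times> ('a \<times> nat \<Rightarrow> 'f) \<Rightarrow> 'f) \<Rightarrow>
    'a set \<times> ('a \<times> nat \<Rightarrow> 'f) \<Rightarrow> 'f" where
  "shift \<omega> \<phi> = (\<lambda>(e, Z). if (e, Z) \<in> slots then \<phi> (e, Z) + \<omega> e Z else 0)"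

lemma inj_shift: "inj_on (shift \<omega>) polys"
proof (rule inj_onI, rule ext)
  fix \<phi> \<phi>' P assume *: "\<phi> \<in> polys" "\<phi>' \<in> polys" "shift \<omega> \<phi> = shift \<omega> \<phi>'"
  show "\<phi> P = \<phi>' P"
  proof (cases "P \<in> slots")
    case True
    then show ?thesis using fun_cong[OF *(3), of P] by (cases P) (auto simp: shift_def)
  next
    case False
    then show ?thesis using *(1,2) by (simp add: polysD)
  qed
qed

lemma shift_polys:
  assumes "\<phi> \<in> polys" "\<And>e Z. e \<in> E \<Longrightarrow> Z \<in> pts e \<Longrightarrow> \<omega> e Z \<in> K"
    and "\<And>e. e \<in> E \<Longrightarrow> sepdeg d (coords e) (\<omega> e)"
  shows "shift \<omega> \<phi> \<in> polys"
proof -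
  obtain \<psi> where \<psi>: "\<forall>e\<in>E. sepdeg d (coords e) (\<psi> e)" "\<forall>e Z. (e, Z) \<in> slots \<longrightarrow> \<phi> (e, Z) = \<psi> e Z"
    and val: "\<And>P. P \<in> slots \<Longrightarrow> \<phi> P \<in> K"
    using assms(1) unfolding polys_def by blast
  have "\<forall>e\<in>E. sepdeg d (coords e) (\<lambda>Z. \<psi> e Z + \<omega> e Z)"
    using \<psi>(1) assms(3) by (auto simp: sepdeg_def intro!: polydeg_add)
  moreover have "\<forall>e Z. (e, Z) \<in> slots \<longrightarrow> shift \<omega> \<phi> (e, Z) = \<psi> e Z + \<omega> e Z"
    using \<psi>(2) by (auto simp: shift_def)
  moreover have "(P \<in> slots \<longrightarrow> shift \<omega> \<phi> P \<in> K) \<and> (P \<notin> slots \<longrightarrow> shift \<omega> \<phi> P = 0)" for P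
    using val assms(2) by (cases P) (auto simp: shift_def slots_def intro!: Kadd)
  ultimately show ?thesis
    unfolding polys_def by (intro CollectI conjI exI[of _ "\<lambda>e Z. \<psi> e Z + \<omega> e Z"]) auto
qed

text \<open>Translate by independent constants, one for each \<open>e\<close>: among the
  \<open>card K ^ card E\<close> choices, the constants \<open>- \<phi> (e, Y e)\<close> make all
  values vanish.\<close>

lemma vanishing_polys:
  assumes "\<And>e. e \<in> E \<Longrightarrow> Y e \<in> pts e"
  shows "card polys \<le> card K ^ card E * card (polys \<inter> {\<phi>. \<forall>e\<in>E. \<phi> (e, Y e) = 0})"
proof -
  have "card polys \<le> card (PiE E (\<lambda>_. K)) * card (polys \<inter> {\<phi>. \<forall>e\<in>E. \<phi> (e, Y e) = 0})"
  proof (rule shift_count_ge[where T = "\<lambda>c. shift (\<lambda>e Z. c e)"])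
    fix c \<phi> assume c: "c \<in> PiE E (\<lambda>_. K)" and \<phi>: "\<phi> \<in> polys"
    show "shift (\<lambda>e Z. c e) \<phi> \<in> polys"
      by (rule shift_polys[OF \<phi>]) (use c in \<open>auto simp: sepdeg_def polydeg_const\<close>)
  next
    fix \<phi> assume \<phi>: "\<phi> \<in> polys"
    have Yd: "(e, Y e) \<in> slots" if "e \<in> E" for e using assms that by (auto simp: slots_def)
    let ?c = "restrict (\<lambda>e. - \<phi> (e, Y e)) E"
    have "?c \<in> PiE E (\<lambda>_. K)"
      using \<phi> Yd by (auto simp: polys_def intro!: Kuminus)
    moreover have "shift (\<lambda>e Z. ?c e) \<phi> \<in> {\<phi>. \<forall>e\<in>E. \<phi> (e, Y e) = 0}"
      using Yd by (auto simp: shift_def)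
    ultimately show "\<exists>c\<in>PiE E (\<lambda>_. K). shift (\<lambda>e Z. c e) \<phi> \<in> {\<phi>. \<forall>e\<in>E. \<phi> (e, Y e) = 0}"
      by blast
  qed (auto simp: finite_polys finite_PiE finE finK inj_shift)
  then show ?thesis by (simp add: card_funcsetE finE)
qed

text \<open>A configuration consists of \<open>k\<close> distinct sets of \<open>r - 1\<close> host vertices, each encoded as
  a slot whose values at the colour \<open>w\<close> are ignored; \<open>common\<close> is the set of its common
  neighbours of colour \<open>w\<close>.\<close>

definition config :: "'a \<Rightarrow> (nat \<Rightarrow> 'a set \<times> ('a \<times> nat \<Rightarrow> 'f)) \<Rightarrow> bool" where
  "config w cf \<longleftrightarrow> (\<forall>i<k. cf i \<in> slots \<and> w \<in> fst (cf i)) \<and>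
    (\<forall>i<k. \<forall>i'<k. i \<noteq> i' \<longrightarrow> fst (cf i) = fst (cf i') \<longrightarrow>
      (\<exists>l\<in>coords (fst (cf i) - {w}). snd (cf i) l \<noteq> snd (cf i') l))"

definition common :: "'a \<Rightarrow> (nat \<Rightarrow> 'a set \<times> ('a \<times> nat \<Rightarrow> 'f)) \<Rightarrow>
    ('a set \<times> ('a \<times> nat \<Rightarrow> 'f) \<Rightarrow> 'f) \<Rightarrow> (nat \<Rightarrow> 'f) set" where
  "common w cf \<phi> = {x \<in> PiE {..<k} (\<lambda>_. K). \<forall>i<k. \<phi> (fst (cf i), plug w (snd (cf i)) x) = 0}"

lemma plug_upd: "plug w Y (x(l := y)) = (plug w Y x)((w, l) := y)"
  by (auto simp: plug_def fun_eq_iff)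

lemma plug_pts:
  assumes "Y \<in> pts e" "x \<in> PiE {..<k} (\<lambda>_. K)" "w \<in> e"
  shows "plug w Y x \<in> pts e"
  using assms by (auto simp: plug_def pts_def coords_def PiE_def extensional_def Pi_def)

text \<open>Averaging over the translates of \<open>\<phi>\<close> by \<open>Om c\<close>, \<open>c \<in> K ^ T\<close>, which perturb the
  \<open>k\<close> polynomials of the configuration simultaneously as in \<open>fibre_bound\<close>.  The factor \<open>Lc i\<close>
  separates the \<open>i\<close>-th vertex set of the configuration from the others.\<close>

lemma config_bound:
  fixes A :: "'f set"
  assumes cf: "config w cf" and j: "j < k"
    and T: "T \<subseteq> K" "card T \<le> Suc d" and A: "finite A" "card A = Suc N" "2 * (k - 1) * d \<le> N"
  shows "card K ^ card T *
      card (polys \<inter> {\<phi>. d * Suc N ^ (k - 1) < card ((\<lambda>x. x j) ` common w cf \<phi>)})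
    \<le> (Suc N ^ (k - 1)) ^ card T * card polys"
proof -
  define e where "e i = fst (cf i)" for i
  define Y where "Y i = snd (cf i)" for i
  have finT: "finite T" using T(1) finK by (rule finite_subset)
  have e: "e i \<in> E" "w \<in> e i" "Y i \<in> pts (e i)" "(e i, Y i) \<in> slots" if "i < k" for i
    using cf that unfolding config_def e_def Y_def slots_def by (auto simp: split_beta)
  define js where "js = filter (\<lambda>l. l \<noteq> j) [0..<k]"
  have js: "distinct (j # js)" "set js = {..<k} - {j}" "set (j # js) = {..<k}" "length js = k - 1"
  proof -
    show "distinct (j # js)" "set js = {..<k} - {j}" "set (j # js) = {..<k}"
      using j by (auto simp: js_def)
    then show "length js = k - 1" using distinct_card[of js] j by auto
  qed
  define I where "I i = {i'. i' < k \<and> i' \<noteq> i \<and> e i' = e i}" for i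
  have "\<exists>l. l \<in> coords (e i - {w}) \<and> Y i l \<noteq> Y i' l" if "i < k" "i' \<in> I i" for i i'
  proof -
    have "i \<noteq> i'" "i' < k" "e i = e i'" using that(2) by (auto simp: I_def)
    then show ?thesis using cf that(1) unfolding config_def e_def Y_def by blast
  qed
  then obtain q where q: "\<And>i i'. i < k \<Longrightarrow> i' \<in> I i \<Longrightarrow> q i i' \<in> coords (e i - {w})"
    "\<And>i i'. i < k \<Longrightarrow> i' \<in> I i \<Longrightarrow> Y i (q i i') \<noteq> Y i' (q i i')"
    by metis
  \<comment> \<open>\<open>Lc i\<close> is 1 at the \<open>i\<close>-th member and 0 at the others
    with the same colour set. Its variables have colours other than \<open>w\<close>, so it is
    constant in the position plugged in at \<open>w\<close>.\<close>
  define Lc where "Lc i Z = (\<Prod>i'\<in>I i. (Z (q i i') - Y i' (q i i')) / (Y i (q i i') - Y i' (q i i')))"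
    for i and Z :: "'a \<times> nat \<Rightarrow> 'f"
  define om where "om \<tau> e' Z = (\<Sum>i\<in>{i. i < k \<and> e i = e'}.
      Lc i Z * lag T \<tau> (Z (w, j)) * esym d js i (\<lambda>l. Z (w, l)))" for \<tau> e' Z
  define Om where "Om c e' Z = (\<Sum>\<tau>\<in>T. c \<tau> * om \<tau> e' Z)" for c :: "'f \<Rightarrow> 'f" and e' Z
  have finI: "finite (I i)" for i by (simp add: I_def)
  have om_K: "om \<tau> e' Z \<in> K" if "\<tau> \<in> T" "Z \<in> pts e'" for \<tau> e' Z
    unfolding om_def
  proof (rule Ksum)
    fix i assume "i \<in> {i. i < k \<and> e i = e'}"
    then have i: "i < k" "e i = e'" by auto
    have XK: "Z p \<in> K" if "p \<in> coords e'" for p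
      using that \<open>Z \<in> pts e'\<close> by (auto simp: pts_def)
    have YK: "Y i' p \<in> K" if "p \<in> coords e'" "i' < k" "e i' = e'" for i' p
      using that e(3)[of i'] by (auto simp: pts_def)
    have wc: "(w, l) \<in> coords e'" if "l < k" for l
      using e(2)[OF i(1)] i(2) that by (auto simp: coords_def)
    have qc: "q i i' \<in> coords e'" if "i' \<in> I i" for i'
      using q(1)[OF i(1) that] i(2) by (auto simp: coords_def)
    have "Lc i Z \<in> K"
      unfolding Lc_def
      by (intro Kprod Kdivide Kdiff XK YK qc) (use i in \<open>auto simp: I_def\<close>)
    moreover have "lag T \<tau> (Z (w, j)) \<in> K"
      using T(1) that(1) XK wc j by (intro Klag) auto
    moreover have "esym d js i (\<lambda>l. Z (w, l)) \<in> K"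
      using js(2) XK wc by (intro Kesym) auto
    ultimately show "Lc i Z * lag T \<tau> (Z (w, j)) * esym d js i (\<lambda>l. Z (w, l)) \<in> K"
      by (intro Kmult)
  qed
  have om_sep: "sepdeg d (coords e') (om \<tau> e')" if "\<tau> \<in> T" for \<tau> e'
    unfolding sepdeg_def om_def
  proof (intro ballI allI, rule polydeg_sum)
    fix p i and Z :: "'a \<times> nat \<Rightarrow> 'f"
    assume p: "p \<in> coords e'" and "i \<in> {i. i < k \<and> e i = e'}"
    then have i: "i < k" "e i = e'" by auto
    obtain c l where pcl: "p = (c, l)" "l < k" using p by (auto simp: coords_def)
    show "polydeg d (\<lambda>y. Lc i (Z(p := y)) * lag T \<tau> ((Z(p := y)) (w, j)) *
        esym d js i (\<lambda>l. (Z(p := y)) (w, l)))"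
    \<comment> \<open>A variable of colour \<open>w\<close> meets either the Lagrange factor or
      \<open>esym\<close>, never both and never \<open>Lc\<close>; any other variable meets only
      \<open>Lc\<close>.\<close>
    proof (cases "c = w")
      case True
      have Lc_eq: "Lc i (Z(p := y)) = Lc i Z" for y
        unfolding Lc_def
      proof (rule prod.cong[OF refl])
        fix i' assume "i' \<in> I i"
        then have "q i i' \<in> coords (e i - {w})" by (rule q(1)[OF i(1)])
        then have "q i i' \<noteq> p" using True by (auto simp: coords_def pcl)
        then show "((Z(p := y)) (q i i') - Y i' (q i i')) / (Y i (q i i') - Y i' (q i i')) =
            (Z (q i i') - Y i' (q i i')) / (Y i (q i i') - Y i' (q i i'))" by simp
      qed
      have X_eq: "(\<lambda>l'. (Z(p := y)) (w, l')) = (\<lambda>l'. Z (w, l'))(l := y)" for y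
        using True by (auto simp: pcl fun_eq_iff)
      show ?thesis
      proof (cases "l = j")
        case True
        have es: "esym d js i ((\<lambda>l'. Z (w, l'))(l := y)) = esym d js i (\<lambda>l'. Z (w, l'))" for y
          by (rule esym_cong) (use js(1) True in auto)
        have "(Z(p := y)) (w, j) = y" for y using True \<open>c = w\<close> by (simp add: pcl)
        moreover have "polydeg d (\<lambda>y. Lc i Z * lag T \<tau> y * esym d js i (\<lambda>l'. Z (w, l')))"
          using that finT T(2) by (intro polydeg_multc polydeg_cmult polydeg_lag)
        ultimately show ?thesis unfolding Lc_eq X_eq es by simp
      next
        case False
        have lj: "l \<in> set js" using False pcl js(2) by auto
        have "polydeg d (\<lambda>y. esym d js i ((\<lambda>l'. Z (w, l'))(l := y)))"
          by (rule sepdegD[OF sepdeg_esym lj]) (use js(1) in simp)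
        moreover have "(Z(p := y)) (w, j) = Z (w, j)" for y using False by (simp add: pcl)
        ultimately show ?thesis unfolding Lc_eq X_eq by (simp add: polydeg_cmult)
      qed
    next
      case False
      have "polydeg (card (I i)) (\<lambda>y. Lc i (Z(p := y)))"
        unfolding Lc_def
      proof (rule polydeg_prod[OF finI])
        fix i'
        show "polydeg 1 (\<lambda>y. ((Z(p := y)) (q i i') - Y i' (q i i')) / (Y i (q i i') - Y i' (q i i')))"
          by (cases "q i i' = p") (simp_all add: polydeg_linear[simplified] polydeg_const)
      qed
      moreover have "card (I i) \<le> d"
      proof -
        have "I i \<subseteq> {..<k} - {i}" by (auto simp: I_def)
        then have "card (I i) \<le> card ({..<k} - {i})" by (intro card_mono) auto
        then show ?thesis using kd i(1) by simp
      qed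
      ultimately have "polydeg d (\<lambda>y. Lc i (Z(p := y)))" by (rule polydeg_mono)
      moreover have "(Z(p := y)) (w, l') = Z (w, l')" for y l' using False by (simp add: pcl)
      ultimately show ?thesis by (simp add: polydeg_multc)
    qed
  qed
  have om_eval: "om \<tau> (e i) (plug w (Y i) x) = lag T \<tau> (x j) * esym d js i x"
    if i: "i < k" for \<tau> i x
  proof -
    let ?Z = "plug w (Y i) x"
    have Xw: "?Z (w, l) = x l" for l by (simp add: plug_def)
    have Xq: "?Z p = Y i p" if "p \<in> coords (e' - {w})" for p e'
      using that by (auto simp: plug_def coords_def split: if_splits)
    have "Lc i' ?Z = (if i' = i then 1 else 0)" if i': "i' < k" "e i' = e i" for i'
    proof (cases "i' = i")
      case True
      have "Lc i ?Z = 1"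
        unfolding Lc_def
        by (rule prod.neutral) (use Xq[OF q(1)[OF i]] q(2)[OF i] in auto)
      then show ?thesis using True by simp
    next
      case False
      then have m: "i \<in> I i'" using i i' by (auto simp: I_def)
      have "?Z (q i' i) - Y i (q i' i) = 0" using Xq[OF q(1)[OF i'(1) m]] by simp
      then have "Lc i' ?Z = 0"
        unfolding Lc_def using m finI by (intro prod_zero[OF finI] bexI[OF _ m]) simp
      then show ?thesis using False by simp
    qed
    then have "om \<tau> (e i) ?Z = (\<Sum>i'\<in>{i'. i' < k \<and> e i' = e i}.
        if i' = i then lag T \<tau> (x j) * esym d js i x else 0)"
      unfolding om_def Xw by (intro sum.cong) auto
    also have "\<dots> = lag T \<tau> (x j) * esym d js i x"
      using i by (subst sum.delta) auto
    finally show ?thesis .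
  qed
  let ?M = "Suc N ^ (k - 1)"
  let ?B = "{\<phi>. d * ?M < card ((\<lambda>x. x j) ` common w cf \<phi>)}"
  have "card (PiE T (\<lambda>_. K)) * card (polys \<inter> ?B) \<le> ?M ^ card T * card polys"
  proof (rule shift_count_le[where T = "\<lambda>c. shift (Om c)"])
    show "finite (PiE T (\<lambda>_. K))" using finT finK by (simp add: finite_PiE)
    fix c \<phi> assume c: "c \<in> PiE T (\<lambda>_. K)" and \<phi>: "\<phi> \<in> polys"
    show "shift (Om c) \<phi> \<in> polys"
    proof (rule shift_polys[OF \<phi>])
      fix e' Z assume "e' \<in> E" "Z \<in> pts e'"
      then show "Om c e' Z \<in> K"
        unfolding Om_def using c om_K by (intro Ksum Kmult) auto
    next
      fix e'
      show "sepdeg d (coords e') (Om c e')"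
        unfolding sepdeg_def Om_def
        by (intro ballI allI polydeg_sum polydeg_cmult) (rule sepdegD[OF om_sep])
    qed
  next
    fix \<phi> assume \<phi>: "\<phi> \<in> polys"
    then obtain \<psi> where \<psi>: "\<And>e. e \<in> E \<Longrightarrow> sepdeg d (coords e) (\<psi> e)"
      "\<And>e Z. (e, Z) \<in> slots \<Longrightarrow> \<phi> (e, Z) = \<psi> e Z"
      unfolding polys_def by blast
    define g where "g i x = \<psi> (e i) (plug w (Y i) x)" for i x
    have g: "sepdeg d (set (j # js)) (g i)" if "i \<le> length js" for i
      unfolding sepdeg_def g_def plug_upd js(3)
    proof (intro ballI allI)
      fix l x assume l: "l \<in> {..<k}"
      have i: "i < k" using that js(4) j by simp
      show "polydeg d (\<lambda>y. \<psi> (e i) ((plug w (Y i) x)((w, l) := y)))"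
        by (rule sepdegD[OF \<psi>(1)[OF e(1)[OF i]]]) (use l e(2)[OF i] in \<open>auto simp: coords_def\<close>)
    qed
    define G where "G c i x = g i x + (\<Sum>\<tau>\<in>T. c \<tau> * lag T \<tau> (x j) * esym d js i x)" for c i x
    \<comment> \<open>Elements of \<open>common\<close> are extensional, whence
      \<open>undefined\<close> outside \<open>{..<k}\<close>. The range
      \<open>i \<le> length js\<close> comprises all \<open>k\<close> equations, since
      \<open>length js = k - 1\<close>.\<close>
    define S where "S c = {z j |z. (\<forall>l. l \<notin> set (j # js) \<longrightarrow> z l = undefined) \<and>
      (\<forall>i\<le>length js. G c i z = 0)}" for c
    have "\<exists>R. (\<forall>\<tau>\<in>T. finite (R \<tau>) \<and> card (R \<tau>) \<le> Suc N ^ length js) \<and>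
      (\<forall>c. (\<exists>\<tau>\<in>T. c \<tau> \<notin> R \<tau>) \<longrightarrow> finite (S c) \<and> card (S c) \<le> d * Suc N ^ length js)"
      unfolding S_def G_def
    proof (rule fibre_bound[OF js(1) _ A(1,2) finT T(2)])
      show "2 * length js * d \<le> N" using A(3) js(4) by simp
    qed (rule g)
    then obtain R where R: "\<And>\<tau>. \<tau> \<in> T \<Longrightarrow> finite (R \<tau>)" "\<And>\<tau>. \<tau> \<in> T \<Longrightarrow> card (R \<tau>) \<le> ?M"
      "\<And>c \<tau>. \<tau> \<in> T \<Longrightarrow> c \<tau> \<notin> R \<tau> \<Longrightarrow> finite (S c)"
      "\<And>c \<tau>. \<tau> \<in> T \<Longrightarrow> c \<tau> \<notin> R \<tau> \<Longrightarrow> card (S c) \<le> d * ?M"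
      unfolding js(4) by metis
    \<comment> \<open>A bad \<open>c\<close> fails at every node simultaneously, so it lies in a
      product of small sets; this yields the power \<open>card T\<close>.\<close>
    have "{c \<in> PiE T (\<lambda>_. K). shift (Om c) \<phi> \<in> ?B} \<subseteq> PiE T R"
    proof
      fix c assume "c \<in> {c \<in> PiE T (\<lambda>_. K). shift (Om c) \<phi> \<in> ?B}"
      then have c: "c \<in> PiE T (\<lambda>_. K)" and
        big: "d * ?M < card ((\<lambda>x. x j) ` common w cf (shift (Om c) \<phi>))" by auto
      have sub: "(\<lambda>x. x j) ` common w cf (shift (Om c) \<phi>) \<subseteq> S c"
      proof
        fix \<beta> assume "\<beta> \<in> (\<lambda>x. x j) ` common w cf (shift (Om c) \<phi>)"
        then obtain x where x: "\<beta> = x j" "x \<in> PiE {..<k} (\<lambda>_. K)"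
          "\<forall>i<k. shift (Om c) \<phi> (e i, plug w (Y i) x) = 0"
          by (auto simp: common_def e_def Y_def)
        have "G c i x = 0" if "i \<le> length js" for i
        proof -
          have i: "i < k" using that js(4) j by simp
          have d: "(e i, plug w (Y i) x) \<in> slots"
            using e[OF i] plug_pts[OF e(3)[OF i] x(2)] by (auto simp: slots_def)
          have "0 = \<phi> (e i, plug w (Y i) x) + Om c (e i) (plug w (Y i) x)"
            using x(3) i d by (auto simp: shift_def)
          also have "\<dots> = G c i x"
            using \<psi>(2)[OF d] by (simp add: G_def g_def Om_def om_eval[OF i] mult.assoc)
          finally show ?thesis by simp
        qed
        moreover have "x l = undefined" if "l \<notin> set (j # js)" for l
          using x(2) that unfolding js(3) by (rule PiE_arb)
        ultimately show "\<beta> \<in> S c" unfolding S_def x(1) by blast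
      qed
      have "c \<tau> \<in> R \<tau>" if "\<tau> \<in> T" for \<tau>
      proof (rule ccontr)
        assume "c \<tau> \<notin> R \<tau>"
        then have "card ((\<lambda>x. x j) ` common w cf (shift (Om c) \<phi>)) \<le> d * ?M"
          using card_mono[OF R(3)[OF that, of c] sub] R(4)[OF that, of c] by simp
        then show False using big by simp
      qed
      then show "c \<in> PiE T R" using c by (auto simp: PiE_def)
    qed
    then have "card {c \<in> PiE T (\<lambda>_. K). shift (Om c) \<phi> \<in> ?B} \<le> card (PiE T R)"
      using finT R(1) by (intro card_mono finite_PiE)
    also have "\<dots> = (\<Prod>\<tau>\<in>T. card (R \<tau>))" using finT by (rule card_PiE)
    also have "\<dots> \<le> (\<Prod>\<tau>\<in>T. ?M)" by (rule prod_mono) (use R(2) in auto)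
    finally show "card {c \<in> PiE T (\<lambda>_. K). shift (Om c) \<phi> \<in> ?B} \<le> ?M ^ card T" by simp
  qed (auto simp: finite_polys inj_shift)
  then show ?thesis using finT by (simp add: card_funcsetE)
qed

end

section \<open>Averaging: existence of a good system of polynomials\<close>

context random_polynomials
begin

lemma card_pts: "e \<in> E \<Longrightarrow> card (pts e) = card K ^ (card e * k)"
  unfolding pts_def coords_def by (subst card_funcsetE) (auto simp: fin_edge)

lemma K_pos: "0 < card K"
  using finK K0 by (auto simp: card_gt_0_iff)

lemma card_slots: "card slots \<le> card E * card K ^ (k * card V)"
proof -
  have "card slots = (\<Sum>e\<in>E. card (pts e))"
    unfolding slots_def
    by (rule card_SigmaI) (auto simp: finE pts_def coords_def fin_edge finK intro!: finite_PiE)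
  also have "\<dots> \<le> (\<Sum>e\<in>E. card K ^ (k * card V))"
  proof (rule sum_mono)
    fix e assume e: "e \<in> E"
    have "card e * k \<le> k * card V"
      using e EV finV card_mono[of V e] by (auto simp: mult.commute)
    then show "card (pts e) \<le> card K ^ (k * card V)"
      using K_pos by (simp add: card_pts[OF e] power_increasing)
  qed
  finally show ?thesis by simp
qed

lemma zero_polys: "(\<lambda>_. 0) \<in> polys"
  unfolding polys_def
  by (intro CollectI conjI exI[of _ "\<lambda>_ _. 0"]) (auto simp: K0 sepdeg_def polydeg_const)

text \<open>The set lies in the box spanned by its coordinate projections.\<close>

lemma common_card_le:
  assumes "\<And>j. j < k \<Longrightarrow> card ((\<lambda>x. x j) ` common w cf \<phi>) \<le> b"
  shows "card (common w cf \<phi>) \<le> b ^ k"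
proof -
  have fin: "finite (common w cf \<phi>)"
    by (rule finite_subset[of _ "PiE {..<k} (\<lambda>_. K)"]) (auto simp: common_def finK intro!: finite_PiE)
  have "common w cf \<phi> \<subseteq> PiE {..<k} (\<lambda>j. (\<lambda>x. x j) ` common w cf \<phi>)"
    by (auto simp: common_def)
  then have "card (common w cf \<phi>) \<le> card (PiE {..<k} (\<lambda>j. (\<lambda>x. x j) ` common w cf \<phi>))"
    using fin by (intro card_mono finite_PiE) auto
  also have "\<dots> = (\<Prod>j<k. card ((\<lambda>x. x j) ` common w cf \<phi>))" by (rule card_PiE) simp
  also have "\<dots> \<le> (\<Prod>j<k. b)" by (rule prod_mono) (use assms in auto)
  finally show ?thesis by simp
qed

text \<open>Union bound and first moment. The exponent \<open>t\<close> pays for the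
  \<open>card K ^ (k * k * card V)\<close> in the number of configurations and leaves a factor
  \<open>card K ^ Suc (card E)\<close>. So the bad functions have density at most
  \<open>1 / (4 * card K ^ card E)\<close>, too little to carry the average number of
  placements.\<close>

lemma good_polys_exist:
  fixes A :: "'f set" and N :: nat
  defines "t \<equiv> k * k * card V + card E + 1"
  defines "M \<equiv> Suc N ^ (k - 1)"
  assumes T: "T \<subseteq> K" "card T = t" "t \<le> Suc d"
    and A: "finite A" "card A = Suc N" "2 * (k - 1) * d \<le> N"
    and q: "4 * (card V * card E ^ k * k * M ^ t) \<le> card K"
  shows "\<exists>\<phi>\<in>polys. (\<forall>w\<in>V. \<forall>cf. config w cf \<longrightarrow> card (common w cf \<phi>) \<le> (d * M) ^ k) \<and>
    card K ^ (k * card V) \<le> 2 * card K ^ card E *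
      card {y \<in> PiE (coords V) (\<lambda>_. K). \<forall>e\<in>E. \<phi> (e, restrict y (coords e)) = 0}"
proof -
  define q where "q = card K"
  define C where "C = {(w, cf). w \<in> V \<and> cf \<in> PiE {..<k} (\<lambda>_. slots) \<and> config w cf}"
  define bad where "bad = (\<lambda>((w, cf), j). polys \<inter> {\<phi>. d * M < card ((\<lambda>x. x j) ` common w cf \<phi>)})"
  define Bad where "Bad = \<Union> (bad ` (C \<times> {..<k}))"
  define C1 where "C1 = card V * card E ^ k * k * M ^ t"
  have q0: "0 < q" using K_pos by (simp add: q_def)
  have fin: "finite (V \<times> PiE {..<k} (\<lambda>_. slots))"
    by (intro finite_cartesian_product finite_PiE) (auto simp: finV finite_slots)
  have Csub: "C \<subseteq> V \<times> PiE {..<k} (\<lambda>_. slots)" by (auto simp: C_def)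
  have finC: "finite C" using Csub fin by (rule finite_subset)
  have "card C \<le> card (V \<times> PiE {..<k} (\<lambda>_. slots))" by (rule card_mono[OF fin Csub])
  also have "\<dots> = card V * card slots ^ k" by (simp add: card_cartesian_product card_funcsetE)
  also have "\<dots> \<le> card V * (card E * q ^ (k * card V)) ^ k"
    unfolding q_def by (intro mult_le_mono2 power_mono card_slots) simp
  also have "\<dots> = card V * card E ^ k * q ^ (k * k * card V)"
    by (simp add: power_mult_distrib power_mult[symmetric] ac_simps)
  finally have cardC: "card C \<le> card V * card E ^ k * q ^ (k * k * card V)" .
  have Bad_sub: "Bad \<subseteq> polys" by (auto simp: Bad_def bad_def)
  have "q ^ t * card Bad \<le> q ^ t * (\<Sum>i\<in>C \<times> {..<k}. card (bad i))"
    unfolding Bad_def using finC by (intro mult_le_mono2 card_UN_le) simp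
  also have "\<dots> \<le> (\<Sum>i\<in>C \<times> {..<k}. M ^ t * card polys)"
    unfolding sum_distrib_left
  proof (rule sum_mono)
    fix i assume "i \<in> C \<times> {..<k}"
    then obtain w cf j where i: "i = ((w, cf), j)" "config w cf" "j < k" by (auto simp: C_def)
    show "q ^ t * card (bad i) \<le> M ^ t * card polys"
      using config_bound[OF i(2,3) T(1) _ A] T(2,3) by (simp add: i(1) bad_def M_def q_def)
  qed
  also have "\<dots> = card C * (k * M ^ t * card polys)" using finC by (simp add: card_cartesian_product)
  also have "\<dots> \<le> card V * card E ^ k * q ^ (k * k * card V) * (k * M ^ t * card polys)"
    by (intro mult_le_mono1 cardC)
  also have "\<dots> = q ^ (k * k * card V) * (C1 * card polys)" by (simp add: C1_def ac_simps)
  finally have "q ^ (k * k * card V) * (q ^ Suc (card E) * card Bad) \<le> q ^ (k * k * card V) * (C1 * card polys)"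
    by (simp add: t_def power_add mult.assoc)
  then have "q ^ Suc (card E) * card Bad \<le> C1 * card polys" using q0 by simp
  then have "4 * (q ^ Suc (card E) * card Bad) \<le> 4 * C1 * card polys" by simp
  also have "\<dots> \<le> q * card polys" using q by (intro mult_le_mono1) (simp add: C1_def q_def)
  finally have "q * (4 * q ^ card E * card Bad) \<le> q * card polys" by (simp add: ac_simps)
  then have Bad_card: "4 * q ^ card E * card Bad \<le> card polys" using q0 by simp
  define Ys where "Ys = PiE (coords V) (\<lambda>_. K)"
  define R where "R \<phi> y \<longleftrightarrow> (\<forall>e\<in>E. \<phi> (e, restrict y (coords e)) = 0)"
    for \<phi> :: "'a set \<times> ('a \<times> nat \<Rightarrow> 'f) \<Rightarrow> 'f" and y
  define cnt where "cnt \<phi> = card {y \<in> Ys. R \<phi> y}" for \<phi>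
  have finYs: "finite Ys" using finV finK by (auto simp: Ys_def coords_def intro!: finite_PiE)
  have cYs: "card Ys = q ^ (k * card V)"
    using finV by (simp add: Ys_def coords_def card_funcsetE card_cartesian_product q_def mult.commute)
  have "card Ys * card polys = (\<Sum>y\<in>Ys. card polys)" by simp
  also have "\<dots> \<le> (\<Sum>y\<in>Ys. q ^ card E * card {\<phi> \<in> polys. R \<phi> y})"
  proof (rule sum_mono)
    fix y assume y: "y \<in> Ys"
    have "card polys \<le> q ^ card E * card (polys \<inter> {\<phi>. \<forall>e\<in>E. \<phi> (e, restrict y (coords e)) = 0})"
      unfolding q_def
    proof (rule vanishing_polys)
      fix e assume "e \<in> E"
      then have "coords e \<subseteq> coords V" using EV by (auto simp: coords_def)
      then show "restrict y (coords e) \<in> pts e" using y by (auto simp: pts_def Ys_def PiE_def Pi_def)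
    qed
    then show "card polys \<le> q ^ card E * card {\<phi> \<in> polys. R \<phi> y}" by (simp add: R_def Int_def)
  qed
  also have "\<dots> = q ^ card E * (\<Sum>y\<in>Ys. card {\<phi> \<in> polys. R \<phi> y})" by (simp add: sum_distrib_left)
  also have "(\<Sum>y\<in>Ys. card {\<phi> \<in> polys. R \<phi> y}) = (\<Sum>\<phi>\<in>polys. cnt \<phi>)"
    unfolding cnt_def
    by (rule sum_multicount_gen[OF finite_polys finYs, symmetric]) simp
  finally have total: "card Ys * card polys \<le> q ^ card E * (\<Sum>\<phi>\<in>polys. cnt \<phi>)" .
  \<comment> \<open>Otherwise the good functions carry at most half of the guaranteed total and
    \<open>Bad\<close> at most a quarter.\<close>
  have "\<exists>\<phi>\<in>polys - Bad. card Ys \<le> 2 * q ^ card E * cnt \<phi>"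
  proof (rule ccontr)
    assume "\<not> ?thesis"
    then have small: "2 * q ^ card E * cnt \<phi> \<le> card Ys" if "\<phi> \<in> polys - Bad" for \<phi>
      using that by force
    have split: "(\<Sum>\<phi>\<in>polys. cnt \<phi>) = (\<Sum>\<phi>\<in>polys - Bad. cnt \<phi>) + (\<Sum>\<phi>\<in>Bad. cnt \<phi>)"
      using Bad_sub finite_polys by (rule sum.subset_diff)
    have "2 * q ^ card E * (\<Sum>\<phi>\<in>polys - Bad. cnt \<phi>) \<le> (\<Sum>\<phi>\<in>polys - Bad. card Ys)"
      unfolding sum_distrib_left by (rule sum_mono) (use small in auto)
    also have "\<dots> \<le> card polys * card Ys"
      using finite_polys by (simp add: card_mono)
    finally have a: "2 * q ^ card E * (\<Sum>\<phi>\<in>polys - Bad. cnt \<phi>) \<le> card polys * card Ys" .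
    have "(\<Sum>\<phi>\<in>Bad. cnt \<phi>) \<le> (\<Sum>\<phi>\<in>Bad. card Ys)"
      unfolding cnt_def using finYs by (intro sum_mono card_mono) auto
    then have "4 * q ^ card E * (\<Sum>\<phi>\<in>Bad. cnt \<phi>) \<le> 4 * q ^ card E * (card Bad * card Ys)"
      by (intro mult_le_mono2) simp
    also have "\<dots> = (4 * q ^ card E * card Bad) * card Ys" by simp
    also have "\<dots> \<le> card polys * card Ys" by (rule mult_le_mono1[OF Bad_card])
    finally have b: "4 * q ^ card E * (\<Sum>\<phi>\<in>Bad. cnt \<phi>) \<le> card polys * card Ys" .
    have "0 < card polys * card Ys"
      using zero_polys finite_polys q0 by (auto simp: cYs card_gt_0_iff)
    moreover have "card polys * card Ys \<le>
        q ^ card E * (\<Sum>\<phi>\<in>polys - Bad. cnt \<phi>) + q ^ card E * (\<Sum>\<phi>\<in>Bad. cnt \<phi>)"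
      using total unfolding split by (simp add: algebra_simps)
    ultimately show False using a b by (simp only: mult.assoc)
  qed
  then obtain \<phi> where \<phi>: "\<phi> \<in> polys" "\<phi> \<notin> Bad" "card Ys \<le> 2 * q ^ card E * cnt \<phi>" by auto
  have "card (common w cf \<phi>) \<le> (d * M) ^ k" if "w \<in> V" "config w cf" for w cf
  proof (rule common_card_le, rule ccontr)
    fix j assume j: "j < k" and "\<not> card ((\<lambda>x. x j) ` common w cf \<phi>) \<le> d * M"
    \<comment> \<open>Restricting \<open>cf\<close> to \<open>{..<k}\<close> puts it into the finite
      family \<open>C\<close> over which the union bound ran.\<close>
    moreover have "common w cf \<phi> = common w (restrict cf {..<k}) \<phi>" by (auto simp: common_def)
    moreover have "(w, restrict cf {..<k}) \<in> C"
      using that by (auto simp: C_def config_def)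
    ultimately have "\<phi> \<in> Bad" unfolding Bad_def
      by (intro UN_I[of "((w, restrict cf {..<k}), j)"]) (use \<phi>(1) in \<open>auto simp: bad_def\<close>)
    then show False using \<phi>(2) by simp
  qed
  then show ?thesis using \<phi> unfolding cYs unfolding cnt_def R_def Ys_def q_def by blast
qed

end

subsection \<open>Finite fields of characteristic two\<close>

lemma CHAR_bit: "CHAR(bit) = 2"
proof (rule CHAR_eqI)
  fix n assume "of_nat n = (0 :: bit)"
  then show "2 dvd n" by (simp add: even_of_nat_iff[where 'a = bit, symmetric])
qed simp

lemma CHAR_bit_alg_closure: "CHAR(bit alg_closure) = 2"
  by (simp add: CHAR_bit)

lemma bit_alg_closure_two_eq_zero: "of_nat 2 = (0 :: bit alg_closure)"
  using of_nat_CHAR[where 'a = "bit alg_closure"] unfolding CHAR_bit_alg_closure .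

text \<open>\<open>K\<close> is the root set of \<open>X ^ q - X\<close> in an algebraic closure.
  The derivative is \<open>- 1\<close>, so the \<open>q\<close> roots are distinct; closure under
  addition is the Frobenius identity.\<close>

lemma finite_subfield_exists:
  fixes a :: nat
  assumes "0 < a"
  defines "K \<equiv> {x :: bit alg_closure. x ^ (2 ^ a) = x}"
  shows "finite K" "card K = 2 ^ a" "0 \<in> K" "1 \<in> K"
    "x \<in> K \<Longrightarrow> y \<in> K \<Longrightarrow> x + y \<in> K" "x \<in> K \<Longrightarrow> y \<in> K \<Longrightarrow> x * y \<in> K"
    "x \<in> K \<Longrightarrow> - x \<in> K" "x \<in> K \<Longrightarrow> inverse x \<in> K"
proof -
  define q :: nat where "q = 2 ^ a"
  have q: "1 < q" using assms(1) unfolding q_def by (intro one_less_power) auto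
  have K: "K = {x. x ^ q = x}" by (simp add: K_def q_def)
  define P :: "bit alg_closure poly" where "P = Polynomial.monom 1 q - Polynomial.monom 1 1"
  have deg: "Polynomial.degree P = q"
  proof (rule order.antisym)
    show "Polynomial.degree P \<le> q"
      unfolding P_def using q
      by (intro degree_diff_le order.trans[OF degree_monom_le]) auto
    show "q \<le> Polynomial.degree P"
      by (rule le_degree) (use q in \<open>simp add: P_def\<close>)
  qed
  then have P0: "P \<noteq> 0" using q by auto
  have "of_nat q = (0 :: bit alg_closure)"
    unfolding q_def using assms(1) bit_alg_closure_two_eq_zero by (simp add: of_nat_power power_0_left)
  then have pderiv_P: "poly (pderiv P) x = - 1" for x
    by (simp add: P_def pderiv_diff pderiv_monom poly_monom)
  obtain A where A: "size A = Polynomial.degree P"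
    "P = Polynomial.smult (Polynomial.lead_coeff P) (\<Prod>x\<in>#A. [:- x, 1:])"
    using alg_closed_imp_factorization[OF P0] by blast
  have roots: "poly P x = 0 \<longleftrightarrow> x \<in># A" for x
  proof -
    have "poly P x = Polynomial.lead_coeff P * (\<Prod>y\<in>#A. x - y)"
      by (subst A(2)) (simp add: poly_prod_mset image_mset.compositionality o_def)
    then show ?thesis using P0 by (auto simp: prod_mset_zero_iff)
  qed
  have "count A x \<le> 1" for x
  proof (rule ccontr)
    assume "\<not> count A x \<le> 1"
    then have "{#x, x#} \<subseteq># A" by (intro mset_subset_eqI) auto
    then obtain B where "A = {#x, x#} + B" by (auto simp: mset_subset_eq_exists_conv)
    then have "P = [:- x, 1:] * ([:- x, 1:] * Polynomial.smult (Polynomial.lead_coeff P) (\<Prod>x\<in>#B. [:- x, 1:]))"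
      using A(2) by simp
    then obtain R where "P = [:- x, 1:] * ([:- x, 1:] * R)" by blast
    then have "poly (pderiv P) x = 0" by (simp only: pderiv_mult) simp
    then show False using pderiv_P[of x] by simp
  qed
  moreover have "count A x = 0 \<longleftrightarrow> x \<notin># A" for x by (simp add: count_eq_zero_iff)
  ultimately have "count A x = 1" if "x \<in># A" for x using that by (metis le_Suc_eq le_zero_eq One_nat_def)
  then have "size A = card (set_mset A)" by (simp add: size_multiset_overloaded_eq)
  moreover have "K = set_mset A"
    using roots by (auto simp: K P_def poly_monom)
  ultimately show "finite K" "card K = 2 ^ a" using A(1) deg by (simp_all add: q_def)
  show "0 \<in> K" "1 \<in> K" "x \<in> K \<Longrightarrow> y \<in> K \<Longrightarrow> x * y \<in> K" "x \<in> K \<Longrightarrow> inverse x \<in> K"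
    using q by (auto simp: K power_mult_distrib power_inverse)
  show add: "x + y \<in> K" if "x \<in> K" "y \<in> K" for x y
  proof -
    have "(x + y) ^ q = x ^ q + y ^ q"
      by (rule freshmans_dream'[of _ a]) (simp_all add: CHAR_bit q_def)
    then show ?thesis using that by (simp add: K)
  qed
  show "- x \<in> K" if "x \<in> K" for x
  proof -
    have "x + x = of_nat 2 * x" by (simp only: of_nat_numeral mult_2)
    then have "- x = x" unfolding bit_alg_closure_two_eq_zero mult_zero_left by (rule minus_unique)
    then show ?thesis using that by (simp only:)
  qed
qed

subsection \<open>The host hypergraph\<close>

lemma verts_complete_partite:
  "verts (complete_partite ts) = {(i, j). i < length ts \<and> j < ts ! i}"
  by (auto simp: complete_partite_def Let_def Defs.part_def)

lemma transversal_edge: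
  assumes "\<And>i. i < length ts \<Longrightarrow> \<sigma> i < ts ! i"
  shows "(\<lambda>i. (i, \<sigma> i)) ` {..<length ts} \<in> edges (complete_partite ts)"
proof -
  let ?e = "(\<lambda>i. (i, \<sigma> i)) ` {..<length ts}"
  have "card ?e = length ts" by (subst card_image) (auto simp: inj_on_def)
  moreover have "card (?e \<inter> part ts i) = 1" if "i < length ts" for i
  proof -
    have "?e \<inter> part ts i = {(i, \<sigma> i)}" using assms that by (auto simp: Defs.part_def)
    then show ?thesis by simp
  qed
  moreover have "?e \<subseteq> (\<Union>i<length ts. part ts i)" using assms by (auto simp: Defs.part_def)
  ultimately show ?thesis by (simp add: complete_partite_def Let_def)
qed

lemma exists_large_fibre:
  assumes "finite Y" "finite V" "f ` Y \<subseteq> V" "card V * C < card Y"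
  shows "\<exists>w\<in>V. C < card {y \<in> Y. f y = w}"
proof (rule ccontr)
  assume "\<not> ?thesis"
  then have le: "card {y \<in> Y. f y = w} \<le> C" if "w \<in> V" for w using that by force
  have "card Y = (\<Sum>w\<in>V. card {y \<in> Y. f y = w})"
    using sum_fun_comp[OF assms(1-3), of "\<lambda>_. 1 :: nat"] by simp
  also have "\<dots> \<le> (\<Sum>w\<in>V. C)" by (rule sum_mono) (rule le)
  finally show False using assms(4) by simp
qed

context random_polynomials
begin

text \<open>The restriction makes positions extensional, so that equal positions are equal
  functions.\<close>

definition vertex :: "('a \<times> nat \<Rightarrow> 'f) \<Rightarrow> 'a \<Rightarrow> 'a \<times> (nat \<Rightarrow> 'f)" where
  "vertex Z w = (w, restrict (\<lambda>l. Z (w, l)) {..<k})"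

definition host_edges :: "('a set \<times> ('a \<times> nat \<Rightarrow> 'f) \<Rightarrow> 'f) \<Rightarrow> ('a \<times> (nat \<Rightarrow> 'f)) set set" where
  "host_edges \<phi> = {vertex Z ` e |e Z. (e, Z) \<in> slots \<and> \<phi> (e, Z) = 0}"

lemma fst_vertex: "fst ` vertex Z ` e = e"
  by (force simp: vertex_def image_iff)

lemma inj_on_fst_vertex: "inj_on fst (vertex Z ` e)"
  by (auto simp: inj_on_def vertex_def)

text \<open>By pigeonhole more than \<open>C\<close> vertices of the last part share a colour
  \<open>w\<close>. The \<open>k\<close> transversals of the other parts, completed by
  \<open>w\<close>, form a configuration, and those vertices would all be among its common
  neighbours.\<close>

lemma no_complete_partite:
  assumes r: "1 \<le> r"
    and s: "length s = r - 1" "prod_list s = k" "\<forall>x\<in>set s. 0 < x"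
    and C: "\<And>w cf. w \<in> V \<Longrightarrow> config w cf \<Longrightarrow> card (common w cf \<phi>) \<le> C"
    and p: "card V * C < p"
    and inj: "inj_on g (verts (complete_partite (s @ [p])))"
    and g: "\<And>ed. ed \<in> edges (complete_partite (s @ [p])) \<Longrightarrow> g ` ed \<in> host_edges \<phi>"
  shows False
proof -
  define m where "m = r - 1"
  have m: "length s = m" "r = Suc m" using s(1) r by (auto simp: m_def)
  define \<Sigma> where "\<Sigma> = PiE {..<m} (\<lambda>i. {..<s ! i})"
  define A where "A \<sigma> = (\<lambda>i. g (i, \<sigma> i)) ` {..<m}" for \<sigma>
  have inj_g: "i = i' \<and> j = j'"
    if "g (i, j) = g (i', j')" "i < Suc m" "i' < Suc m" "j < (s @ [p]) ! i" "j' < (s @ [p]) ! i'" for i j i' j'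
    using inj_onD[OF inj that(1)] that(2-) m by (auto simp: verts_complete_partite)
  have s_nth: "(s @ [p]) ! i = s ! i" if "i < m" for i using that m by (simp add: nth_append)
  have p_nth: "(s @ [p]) ! m = p" using m by (simp add: nth_append)
  have edge: "insert (g (m, y)) (A \<sigma>) \<in> host_edges \<phi>" if \<sigma>: "\<sigma> \<in> \<Sigma>" and y: "y < p" for \<sigma> y
  proof -
    have "(\<lambda>i. (i, (if i = m then y else \<sigma> i))) ` {..<length (s @ [p])} \<in> edges (complete_partite (s @ [p]))"
      by (rule transversal_edge) (use \<sigma> y m in \<open>auto simp: \<Sigma>_def nth_append PiE_def Pi_def\<close>)
    also have "{..<length (s @ [p])} = insert m {..<m}" using m by auto
    also have "(\<lambda>i. (i, (if i = m then y else \<sigma> i))) ` insert m {..<m} = insert (m, y) ((\<lambda>i. (i, \<sigma> i)) ` {..<m})"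
      by auto
    finally have "g ` insert (m, y) ((\<lambda>i. (i, \<sigma> i)) ` {..<m}) \<in> host_edges \<phi>" by (rule g)
    then show ?thesis by (simp add: A_def image_image)
  qed
  have new: "g (m, y) \<notin> A \<sigma>" if \<sigma>: "\<sigma> \<in> \<Sigma>" and y: "y < p" for \<sigma> y
  proof
    assume "g (m, y) \<in> A \<sigma>"
    then obtain i where i: "i < m" "g (m, y) = g (i, \<sigma> i)" by (auto simp: A_def)
    have "\<sigma> i < s ! i" using \<sigma> i(1) by (auto simp: \<Sigma>_def)
    then have "m = i" using inj_g[OF i(2)] i(1) y by (simp add: p_nth s_nth)
    then show False using i(1) by simp
  qed
  \<comment> \<open>Nonempty parts give a transversal \<open>\<sigma>0\<close>, so every vertex of
    the last part lies on an edge and hence in \<open>V \<times> K ^ k\<close>.\<close>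
  have "(\<lambda>i\<in>{..<m}. 0) \<in> \<Sigma>" using s(3) m by (auto simp: \<Sigma>_def)
  then obtain \<sigma>0 where \<sigma>0: "\<sigma>0 \<in> \<Sigma>" by blast
  have colV: "fst (g (m, y)) \<in> V" "snd (g (m, y)) \<in> PiE {..<k} (\<lambda>_. K)" if y: "y < p" for y
  proof -
    obtain e Z where eX: "insert (g (m, y)) (A \<sigma>0) = vertex Z ` e" "(e, Z) \<in> slots"
      using edge[OF \<sigma>0 y] by (auto simp: host_edges_def)
    then obtain c where c: "c \<in> e" "g (m, y) = vertex Z c" by blast
    have e: "e \<in> E" "Z \<in> pts e" using eX(2) by (auto simp: slots_def)
    show "fst (g (m, y)) \<in> V" using c e EV by (auto simp: vertex_def)
    show "snd (g (m, y)) \<in> PiE {..<k} (\<lambda>_. K)"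
      using c e by (auto simp: vertex_def pts_def coords_def)
  qed
  have "\<exists>w\<in>V. C < card {y \<in> {..<p}. fst (g (m, y)) = w}"
    by (rule exists_large_fibre) (use finV colV(1) p in auto)
  then obtain w where w: "w \<in> V" "C < card {y \<in> {..<p}. fst (g (m, y)) = w}" by blast
  define Y where "Y = {y \<in> {..<p}. fst (g (m, y)) = w}"
  have "Y \<noteq> {}" using w(2) unfolding Y_def by (metis card.empty not_less_zero)
  then obtain y0 where y0: "y0 \<in> Y" by blast
  define x where "x y = snd (g (m, y))" for y
  have gy: "g (m, y) = (w, x y)" if "y \<in> Y" for y using that by (auto simp: Y_def x_def)
  have x_inj: "inj_on x Y"
  proof (rule inj_onI)
    fix y y' assume "y \<in> Y" "y' \<in> Y" "x y = x y'"
    then show "y = y'" using inj_g[of m y m y'] gy[of y] gy[of y'] by (auto simp: Y_def p_nth)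
  qed
  have "\<exists>e Z. (e, Z) \<in> slots \<and> \<phi> (e, Z) = 0 \<and> insert (w, x y) (A \<sigma>) = vertex Z ` e"
    if "\<sigma> \<in> \<Sigma>" "y \<in> Y" for \<sigma> y
    using edge[OF that(1), of y] gy[OF that(2)] that(2) by (auto simp: host_edges_def Y_def)
  then obtain ee XX where eX: "\<And>\<sigma> y. \<sigma> \<in> \<Sigma> \<Longrightarrow> y \<in> Y \<Longrightarrow> (ee \<sigma> y, XX \<sigma> y) \<in> slots"
    "\<And>\<sigma> y. \<sigma> \<in> \<Sigma> \<Longrightarrow> y \<in> Y \<Longrightarrow> \<phi> (ee \<sigma> y, XX \<sigma> y) = 0"
    "\<And>\<sigma> y. \<sigma> \<in> \<Sigma> \<Longrightarrow> y \<in> Y \<Longrightarrow> insert (w, x y) (A \<sigma>) = vertex (XX \<sigma> y) ` ee \<sigma> y"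
    by metis
  \<comment> \<open>All completions \<open>y \<in> Y\<close> have colour \<open>w\<close>, so the
    colour set of the edge depends on \<open>\<sigma>\<close> only.\<close>
  define e where "e \<sigma> = insert w (fst ` A \<sigma>)" for \<sigma>
  have ee: "ee \<sigma> y = e \<sigma>" if "\<sigma> \<in> \<Sigma>" "y \<in> Y" for \<sigma> y
    using arg_cong[OF eX(3)[OF that], of "(`) fst"] by (simp add: fst_vertex e_def)
  have new': "(w, x y) \<notin> A \<sigma>" if "\<sigma> \<in> \<Sigma>" "y \<in> Y" for \<sigma> y
    using new[OF that(1), of y] gy[OF that(2)] that(2) by (auto simp: Y_def)
  have A_vertex: "A \<sigma> = vertex (XX \<sigma> y) ` (e \<sigma> - {w})" if "\<sigma> \<in> \<Sigma>" "y \<in> Y" for \<sigma> y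
  proof -
    let ?Z = "XX \<sigma> y"
    have P: "insert (w, x y) (A \<sigma>) = vertex ?Z ` e \<sigma>" using eX(3)[OF that] ee[OF that] by simp
    have "inj_on (vertex ?Z) (e \<sigma>)" by (auto simp: inj_on_def vertex_def)
    moreover have "vertex ?Z w = (w, x y)"
    proof -
      have "(w, x y) \<in> vertex ?Z ` e \<sigma>" using P by blast
      then show ?thesis by (auto simp: vertex_def)
    qed
    moreover have "w \<in> e \<sigma>" by (simp add: e_def)
    ultimately have "vertex ?Z ` (e \<sigma> - {w}) = vertex ?Z ` e \<sigma> - {(w, x y)}"
      by (subst inj_on_image_set_diff[of _ "e \<sigma>"]) auto
    also have "\<dots> = A \<sigma>" using P new'[OF that] by blast
    finally show ?thesis by simp
  qed
  have X_w: "XX \<sigma> y (w, l) = x y l" if "\<sigma> \<in> \<Sigma>" "y \<in> Y" "l < k" for \<sigma> y l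
  proof -
    have "(w, x y) \<in> vertex (XX \<sigma> y) ` ee \<sigma> y" using eX(3)[OF that(1,2)] by blast
    then have "x y = restrict (\<lambda>l. XX \<sigma> y (w, l)) {..<k}" by (auto simp: vertex_def)
    then show ?thesis using that(3) by simp
  qed
  have e_w: "w \<in> e \<sigma>" for \<sigma> by (simp add: e_def)
  have slot: "(e \<sigma>, XX \<sigma> y) \<in> slots" if "\<sigma> \<in> \<Sigma>" "y \<in> Y" for \<sigma> y
    using eX(1)[OF that] ee[OF that] by simp
  \<comment> \<open>Edges over the same \<open>A \<sigma>\<close> differ only in the vertex of
    colour \<open>w\<close>, so the slot of \<open>y0\<close> serves as a reference for all
    \<open>y\<close>.\<close>
  have plug_eq: "XX \<sigma> y = plug w (XX \<sigma> y0) (x y)" if "\<sigma> \<in> \<Sigma>" "y \<in> Y" for \<sigma> y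
  proof (rule PiE_ext)
    show "XX \<sigma> y \<in> PiE (coords (e \<sigma>)) (\<lambda>_. K)"
      using slot[OF that] by (auto simp: slots_def pts_def)
    have "XX \<sigma> y0 \<in> pts (e \<sigma>)" using slot[OF that(1) y0] by (auto simp: slots_def)
    moreover have "x y \<in> PiE {..<k} (\<lambda>_. K)" using colV(2)[of y] that(2) by (auto simp: Y_def x_def)
    ultimately show "plug w (XX \<sigma> y0) (x y) \<in> PiE (coords (e \<sigma>)) (\<lambda>_. K)"
      using plug_pts[OF _ _ e_w] by (simp add: pts_def)
  next
    fix z assume z: "z \<in> coords (e \<sigma>)"
    obtain c l where cl: "z = (c, l)" "c \<in> e \<sigma>" "l < k" using z by (auto simp: coords_def)
    show "XX \<sigma> y z = plug w (XX \<sigma> y0) (x y) z"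
    proof (cases "c = w")
      case True
      then show ?thesis using X_w[OF that cl(3)] by (simp add: cl plug_def)
    next
      case False
      then have "vertex (XX \<sigma> y) c \<in> vertex (XX \<sigma> y0) ` (e \<sigma> - {w})"
        using A_vertex[OF that] A_vertex[OF that(1) y0] cl(2) by blast
      then have "vertex (XX \<sigma> y) c = vertex (XX \<sigma> y0) c" by (auto simp: vertex_def)
      then have "XX \<sigma> y (c, l) = XX \<sigma> y0 (c, l)"
        using cl(3) by (auto simp: vertex_def dest!: fun_cong[of _ _ l])
      then show ?thesis using False by (simp add: cl plug_def)
    qed
  qed
  have "finite \<Sigma>" by (auto simp: \<Sigma>_def intro!: finite_PiE)
  moreover have "card \<Sigma> = k"
  proof -
    have "card \<Sigma> = (\<Prod>i<m. s ! i)" by (simp add: \<Sigma>_def card_PiE)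
    also have "\<dots> = prod_list s" by (simp add: prod.list_conv_set_nth m atLeast0LessThan)
    finally show ?thesis using s(2) by simp
  qed
  ultimately obtain b where b: "bij_betw b {..<k} \<Sigma>"
    using ex_bij_betw_nat_finite[of \<Sigma>] by (auto simp: atLeast0LessThan)
  have b\<Sigma>: "b i \<in> \<Sigma>" if "i < k" for i using b that by (auto simp: bij_betw_def)
  define cf where "cf i = (e (b i), XX (b i) y0)" for i
  have "config w cf"
    unfolding config_def
  proof (intro conjI allI impI)
    fix i assume "i < k"
    then show "cf i \<in> slots" "w \<in> fst (cf i)"
      using slot[OF b\<Sigma> y0] e_w by (auto simp: cf_def)
  next
    fix i i' assume i: "i < k" "i' < k" "i \<noteq> i'" and eq: "fst (cf i) = fst (cf i')"
    \<comment> \<open>Members agreeing off \<open>w\<close> would come from the same vertex set, and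
      injectivity of \<open>g\<close> recovers the transversal from it.\<close>
    show "\<exists>l\<in>coords (fst (cf i) - {w}). snd (cf i) l \<noteq> snd (cf i') l"
    proof (rule ccontr)
      assume "\<not> ?thesis"
      then have same: "XX (b i) y0 z = XX (b i') y0 z" if "z \<in> coords (e (b i) - {w})" for z
        using that by (auto simp: cf_def)
      have "A (b i) = vertex (XX (b i) y0) ` (e (b i) - {w})" by (rule A_vertex[OF b\<Sigma>[OF i(1)] y0])
      also have "\<dots> = vertex (XX (b i') y0) ` (e (b i) - {w})"
        by (rule image_cong) (use same in \<open>auto simp: vertex_def coords_def restrict_def fun_eq_iff\<close>)
      also have "\<dots> = A (b i')" using A_vertex[OF b\<Sigma>[OF i(2)] y0] eq by (simp add: cf_def)
      finally have AA: "A (b i) = A (b i')" .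
      have "b i = b i'"
      proof (rule PiE_ext)
        show "b i \<in> PiE {..<m} (\<lambda>i. {..<s ! i})" "b i' \<in> PiE {..<m} (\<lambda>i. {..<s ! i})"
          using b\<Sigma> i by (auto simp: \<Sigma>_def)
        fix j assume j: "j \<in> {..<m}"
        then have "g (j, b i j) \<in> A (b i')" using AA by (auto simp: A_def)
        then obtain j' where j': "j' < m" "g (j, b i j) = g (j', b i' j')" by (auto simp: A_def)
        have "b i j < s ! j" "b i' j' < s ! j'"
          using b\<Sigma>[OF i(1)] b\<Sigma>[OF i(2)] j j'(1) by (auto simp: \<Sigma>_def)
        then have "j = j' \<and> b i j = b i' j'"
          by (intro inj_g[OF j'(2)]) (use j j'(1) in \<open>simp_all add: s_nth\<close>)
        then show "b i j = b i' j" by metis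
      qed
      then show False using b i by (auto simp: bij_betw_def inj_on_def)
    qed
  qed
  then have "card (common w cf \<phi>) \<le> C" using C w(1) by blast
  moreover have "x ` Y \<subseteq> common w cf \<phi>"
  proof
    fix z assume "z \<in> x ` Y"
    then obtain y where y: "y \<in> Y" "z = x y" by blast
    have "x y \<in> PiE {..<k} (\<lambda>_. K)" using colV(2)[of y] y(1) by (auto simp: Y_def x_def)
    moreover have "\<phi> (e (b i), plug w (XX (b i) y0) (x y)) = 0" if "i < k" for i
      using eX(2)[OF b\<Sigma>[OF that] y(1)] ee[OF b\<Sigma>[OF that] y(1)] plug_eq[OF b\<Sigma>[OF that] y(1)] by simp
    ultimately show "z \<in> common w cf \<phi>" by (simp add: common_def cf_def y(2))
  qed
  moreover have "finite (common w cf \<phi>)"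
    by (rule finite_subset[of _ "PiE {..<k} (\<lambda>_. K)"]) (auto simp: common_def finK intro!: finite_PiE)
  ultimately have "card (x ` Y) \<le> C" using card_mono le_trans by blast
  then show False using w(2) card_image[OF x_inj] by (simp add: Y_def)
qed

text \<open>Each common zero \<open>y\<close> places one vertex of every colour and so gives a copy
  of the counted hypergraph. Since vertices remember their colours, the vertex set of the copy
  determines \<open>y\<close>.\<close>

lemma host_exists:
  assumes unif: "\<And>e. e \<in> E \<Longrightarrow> card e = r" and r: "1 \<le> r"
    and s: "length s = r - 1" "prod_list s = k" "\<forall>x\<in>set s. 0 < x"
    and C: "\<And>w cf. w \<in> V \<Longrightarrow> config w cf \<Longrightarrow> card (common w cf \<phi>) \<le> C"
    and p: "card V * C < p"
    and n: "card V * card K ^ k \<le> n"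
  shows "\<exists>G :: nat hypergraph. uniform_hypergraph r G \<and> card (verts G) = n \<and>
    hypergraph_free r (complete_partite (s @ [p])) G \<and>
    card {y \<in> PiE (coords V) (\<lambda>_. K). \<forall>e\<in>E. \<phi> (e, restrict y (coords e)) = 0}
      \<le> card (copies r (Hypergraph V E) G)"
proof -
  define U where "U = V \<times> PiE {..<k} (\<lambda>_. K)"
  have finU: "finite U" using finV finK by (auto simp: U_def intro!: finite_PiE)
  have cU: "card U \<le> n" using n by (simp add: U_def card_cartesian_product card_funcsetE)
  obtain \<iota> where \<iota>: "bij_betw \<iota> U {0..<card U}" using ex_bij_betw_finite_nat[OF finU] by blast
  then have inj: "inj_on \<iota> U" and im: "\<iota> ` U = {0..<card U}" by (auto simp: bij_betw_def)
  have vU: "vertex y w \<in> U" if "w \<in> V" "\<And>l. l < k \<Longrightarrow> y (w, l) \<in> K" for y w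
    using that by (auto simp: vertex_def U_def)
  have host_sub: "P \<subseteq> U" "card P = r" if "P \<in> host_edges \<phi>" for P
  proof -
    obtain e Z where P: "P = vertex Z ` e" "(e, Z) \<in> slots" using \<open>P \<in> host_edges \<phi>\<close> by (auto simp: host_edges_def)
    have e: "e \<in> E" "Z \<in> pts e" using P(2) by (auto simp: slots_def)
    show "P \<subseteq> U"
      unfolding P(1)
    proof (rule image_subsetI, rule vU)
      fix c assume "c \<in> e"
      then show "c \<in> V" "\<And>l. l < k \<Longrightarrow> Z (c, l) \<in> K"
        using e EV by (auto simp: pts_def coords_def)
    qed
    have "card P = card (fst ` P)" unfolding P(1) by (rule card_image[OF inj_on_fst_vertex, symmetric])
    then show "card P = r" using unif[OF e(1)] by (simp add: P(1) fst_vertex)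
  qed
  \<comment> \<open>Numbers from \<open>card U\<close> on are isolated vertices that bring the order
    up to \<open>n\<close>.\<close>
  define G where "G = Hypergraph {..<n} ((`) \<iota> ` host_edges \<phi>)"
  have "uniform_hypergraph r G"
    unfolding uniform_hypergraph_def
  proof (intro conjI ballI)
    fix ed assume "ed \<in> edges G"
    then obtain P where P: "P \<in> host_edges \<phi>" "ed = \<iota> ` P" by (auto simp: G_def)
    have "ed \<subseteq> {0..<card U}" using host_sub(1)[OF P(1)] im P(2) by blast
    then show "ed \<subseteq> verts G" using cU by (auto simp: G_def)
    show "card ed = r"
      using card_image[OF inj_on_subset[OF inj host_sub(1)[OF P(1)]]] host_sub(2)[OF P(1)] P(2) by simp
  qed (simp add: G_def)
  moreover have "hypergraph_free r (complete_partite (s @ [p])) G"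
    unfolding hypergraph_free_def
  proof (rule ccontr)
    assume "copies r (complete_partite (s @ [p])) G \<noteq> {}"
    then obtain S f where S: "edges S \<subseteq> edges G" and f: "bij_betw f (verts (complete_partite (s @ [p]))) (verts S)"
      "edges S = (\<lambda>e. f ` e) ` edges (complete_partite (s @ [p]))"
      by (auto simp: copies_def subhypergraph_def isomorphic_hypergraphs_def)
    let ?g = "inv_into U \<iota> \<circ> f"
    have g_edge: "f ` ed \<in> (`) \<iota> ` host_edges \<phi>" if "ed \<in> edges (complete_partite (s @ [p]))" for ed
      using S f(2) that by (auto simp: G_def)
    \<comment> \<open>Every vertex of the complete partite hypergraph lies on an edge, so
      \<open>f\<close> avoids the padding vertices and \<open>\<iota>\<close> can be inverted on its
      image.\<close>
    have f_im: "f z \<in> \<iota> ` U" if z: "z \<in> verts (complete_partite (s @ [p]))" for z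
    proof -
      obtain i j where ij: "z = (i, j)" "i < length (s @ [p])" "j < (s @ [p]) ! i"
        using z by (auto simp: verts_complete_partite)
      let ?\<sigma> = "\<lambda>i'. if i' = i then j else 0"
      have pos: "0 < (s @ [p]) ! i'" if "i' < length (s @ [p])" for i'
        using that s(3) p by (auto simp: nth_append)
      have "(\<lambda>i. (i, ?\<sigma> i)) ` {..<length (s @ [p])} \<in> edges (complete_partite (s @ [p]))"
        by (rule transversal_edge) (use ij pos in auto)
      from g_edge[OF this] obtain P where P: "P \<in> host_edges \<phi>"
        "f ` (\<lambda>i. (i, ?\<sigma> i)) ` {..<length (s @ [p])} = \<iota> ` P" by blast
      have "f z \<in> f ` (\<lambda>i. (i, ?\<sigma> i)) ` {..<length (s @ [p])}"
        unfolding ij(1) by (intro imageI image_eqI[of _ _ i]) (use ij in auto)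
      then show ?thesis using P host_sub(1)[OF P(1)] by blast
    qed
    show False
    proof (rule no_complete_partite[OF r s C p])
      show "inj_on ?g (verts (complete_partite (s @ [p])))"
      proof (rule comp_inj_on)
        show "inj_on f (verts (complete_partite (s @ [p])))" using f(1) by (simp add: bij_betw_def)
        show "inj_on (inv_into U \<iota>) (f ` verts (complete_partite (s @ [p])))"
          by (rule inj_on_inv_into) (use f_im in auto)
      qed
      fix ed assume "ed \<in> edges (complete_partite (s @ [p]))"
      from g_edge[OF this] obtain P where P: "P \<in> host_edges \<phi>" "f ` ed = \<iota> ` P" by blast
      have "?g ` ed = inv_into U \<iota> ` \<iota> ` P" by (simp only: image_comp[symmetric] P(2))
      also have "\<dots> = P" by (rule inv_into_image_cancel[OF inj host_sub(1)[OF P(1)]])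
      finally show "?g ` ed \<in> host_edges \<phi>" using P(1) by simp
    qed
  qed
  moreover have "card {y \<in> PiE (coords V) (\<lambda>_. K). \<forall>e\<in>E. \<phi> (e, restrict y (coords e)) = 0}
      \<le> card (copies r (Hypergraph V E) G)" (is "card ?Ys \<le> _")
  proof (rule card_inj_on_le)
    let ?S = "\<lambda>y. Hypergraph (\<iota> ` vertex y ` V) ((\<lambda>e. \<iota> ` vertex y ` e) ` E)"
    show "finite (copies r (Hypergraph V E) G)" by (rule finite_copies) fact
    have yU: "vertex y ` V \<subseteq> U" if "y \<in> ?Ys" for y
      using that by (auto intro!: vU simp: coords_def)
    show "inj_on ?S ?Ys"
    proof (rule inj_onI)
      fix y y' assume y: "y \<in> ?Ys" "y' \<in> ?Ys" and "?S y = ?S y'"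
      then have "\<iota> ` vertex y ` V = \<iota> ` vertex y' ` V" by simp
      then have eq: "vertex y ` V = vertex y' ` V"
        by (simp add: inj_on_image_eq_iff[OF inj yU[OF y(1)] yU[OF y(2)]])
      show "y = y'"
      proof (rule PiE_ext)
        show "y \<in> PiE (coords V) (\<lambda>_. K)" "y' \<in> PiE (coords V) (\<lambda>_. K)" using y by auto
        fix z assume "z \<in> coords V"
        then obtain c l where cl: "z = (c, l)" "c \<in> V" "l < k" by (auto simp: coords_def)
        then have "vertex y c \<in> vertex y' ` V" using eq by blast
        then have "vertex y c = vertex y' c" by (auto simp: vertex_def)
        then show "y z = y' z" using cl by (auto simp: vertex_def dest!: fun_cong[of _ _ l])
      qed
    qed
    show "?S ` ?Ys \<subseteq> copies r (Hypergraph V E) G"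
    proof
      fix S assume "S \<in> ?S ` ?Ys"
      then obtain y where y: "y \<in> ?Ys" "S = ?S y" by blast
      let ?f = "\<lambda>w. \<iota> (vertex y w)"
      have "inj_on (vertex y) V" by (auto simp: inj_on_def vertex_def)
      then have finj: "inj_on ?f V"
        using inj_on_subset[OF inj yU[OF y(1)]] comp_inj_on[of "vertex y" V \<iota>] by (simp add: o_def)
      have "?f ` e \<in> edges G" if e: "e \<in> E" for e
      proof -
        have sub: "coords e \<subseteq> coords V" using e EV by (auto simp: coords_def)
        have "vertex y ` e = vertex (restrict y (coords e)) ` e"
          by (rule image_cong) (auto simp: vertex_def coords_def fun_eq_iff restrict_def)
        moreover have "restrict y (coords e) \<in> pts e"
          using y(1) sub by (auto simp: pts_def PiE_def Pi_def)
        ultimately have "vertex y ` e \<in> host_edges \<phi>"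
          using e y(1) unfolding host_edges_def slots_def by blast
        then show ?thesis by (simp add: G_def image_image[symmetric])
      qed
      moreover have "verts S \<subseteq> verts G"
      proof -
        have "\<iota> ` vertex y ` V \<subseteq> {0..<card U}" using yU[OF y(1)] im by blast
        also have "\<dots> \<subseteq> {..<n}" using cU by auto
        finally show ?thesis by (simp add: G_def y(2))
      qed
      moreover have "card (?f ` e) = r" if "e \<in> E" for e
        using card_image[OF inj_on_subset[OF finj, of e]] unif[OF that] that EV by auto
      moreover have "?f ` e \<subseteq> ?f ` V" if "e \<in> E" for e using that EV by blast
      ultimately have "subhypergraph r S G"
        unfolding subhypergraph_def uniform_hypergraph_def y(2)
        using finV by (auto simp: image_image)
      moreover have "isomorphic_hypergraphs (Hypergraph V E) S"
        unfolding isomorphic_hypergraphs_def y(2)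
        by (rule exI[of _ ?f]) (use finj in \<open>auto simp: bij_betw_def image_image\<close>)
      ultimately show "S \<in> copies r (Hypergraph V E) G" by (simp add: copies_def)
    qed
  qed
  ultimately show ?thesis by (intro exI[of _ G]) (simp add: G_def)
qed

end

subsection \<open>The lower bound\<close>

lemma card_copies_le_ex_number:
  fixes G :: "nat hypergraph"
  assumes "uniform_hypergraph r G" "card (verts G) = n" "hypergraph_free r F G"
  shows "card (copies r T G) \<le> ex_number r n T F"
  unfolding ex_number_def
  by (rule Max_ge[OF finite_copy_counts]) (use assms in \<open>auto simp: copy_counts_def\<close>)

lemma ex_number_lower_bound:
  fixes H :: "'a hypergraph"
  assumes r: "1 \<le> r" and s: "length s = r - 1" "\<forall>x\<in>set s. 0 < x" and H: "uniform_hypergraph r H"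
  shows "\<exists>C q0. \<forall>p a n. card (verts H) * C < p \<longrightarrow> q0 \<le> a \<longrightarrow>
    card (verts H) * (2 ^ a) ^ prod_list s \<le> n \<longrightarrow>
    (2 ^ a) ^ (prod_list s * card (verts H)) \<le>
      2 * (2 ^ a) ^ card (edges H) * ex_number r n H (complete_partite (s @ [p]))"
proof -
  define k where "k = prod_list s"
  define V where "V = verts H"
  define E where "E = edges H"
  define t where "t = k * k * card V + card E + 1"
  \<comment> \<open>\<open>d\<close> admits both \<open>t\<close> interpolation nodes and
    \<open>k - 1\<close> separating factors, and \<open>N\<close> is the elimination bound for it.
    The summands of \<open>q0\<close> serve the union bound, the \<open>t\<close> nodes and the
    \<open>Suc N\<close> grid values, through \<open>a < 2 ^ a\<close>. None of these constants
    depends on \<open>p\<close>, \<open>a\<close> or \<open>n\<close>.\<close>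
  define d where "d = t + k"
  define N where "N = 2 * (k - 1) * d"
  define M where "M = Suc N ^ (k - 1)"
  define q0 where "q0 = 4 * (card V * card E ^ k * k * M ^ t) + t + Suc N"
  have HV: "finite V" "E \<subseteq> Pow V" "\<And>e. e \<in> E \<Longrightarrow> card e = r"
    using H by (auto simp: uniform_hypergraph_def V_def E_def)
  have HH: "Hypergraph V E = H" by (simp add: V_def E_def)
  have "(2 ^ a) ^ (k * card V) \<le> 2 * (2 ^ a) ^ card E * ex_number r n H (complete_partite (s @ [p]))"
    if p: "card V * (d * M) ^ k < p" and a: "q0 \<le> a" and n: "card V * (2 ^ a) ^ k \<le> n" for p a n
  proof -
    have a0: "0 < a" using a by (simp add: q0_def)
    define K where "K = {x :: bit alg_closure. x ^ (2 ^ a) = x}"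
    note K = finite_subfield_exists[OF a0, folded K_def]
    have "a < 2 ^ a" by (rule less_exp)
    then have q: "q0 \<le> card K" unfolding K(2) using a by linarith
    interpret random_polynomials K V E k d
      by unfold_locales (use K HV in \<open>auto simp: d_def\<close>)
    obtain T where T: "T \<subseteq> K" "card T = t"
      using obtain_subset_with_card_n[of t K] q by (auto simp: q0_def)
    obtain A where A: "A \<subseteq> K" "card A = Suc N"
      using obtain_subset_with_card_n[of "Suc N" K] q by (auto simp: q0_def)
    have "\<exists>\<phi>\<in>polys. (\<forall>w\<in>V. \<forall>cf. config w cf \<longrightarrow> card (common w cf \<phi>) \<le> (d * M) ^ k) \<and>
        card K ^ (k * card V) \<le> 2 * card K ^ card E *
        card {y \<in> PiE (coords V) (\<lambda>_. K). \<forall>e\<in>E. \<phi> (e, restrict y (coords e)) = 0}"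
      unfolding M_def
    proof (rule good_polys_exist)
      show "T \<subseteq> K" "card T = k * k * card V + card E + 1" using T by (simp_all add: t_def)
      show "finite A" "card A = Suc N" using A finite_subset K(1) by auto
      show "k * k * card V + card E + 1 \<le> Suc d" by (simp add: d_def t_def)
      show "2 * (k - 1) * d \<le> N" by (simp add: N_def)
      show "4 * (card V * card E ^ k * k * (Suc N ^ (k - 1)) ^ (k * k * card V + card E + 1)) \<le> card K"
        using q by (simp add: q0_def M_def t_def)
    qed
    then obtain \<phi> where \<phi>: "\<And>w cf. w \<in> V \<Longrightarrow> config w cf \<Longrightarrow> card (common w cf \<phi>) \<le> (d * M) ^ k"
      "card K ^ (k * card V) \<le> 2 * card K ^ card E *
        card {y \<in> PiE (coords V) (\<lambda>_. K). \<forall>e\<in>E. \<phi> (e, restrict y (coords e)) = 0}"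
      by blast
    obtain G :: "nat hypergraph" where G: "uniform_hypergraph r G" "card (verts G) = n"
      "hypergraph_free r (complete_partite (s @ [p])) G"
      "card {y \<in> PiE (coords V) (\<lambda>_. K). \<forall>e\<in>E. \<phi> (e, restrict y (coords e)) = 0}
        \<le> card (copies r (Hypergraph V E) G)"
      using host_exists[OF HV(3) r s(1) k_def[symmetric] s(2) \<phi>(1) p] n K(2) by auto
    have "card K ^ (k * card V) \<le> 2 * card K ^ card E * card (copies r H G)"
      using \<phi>(2) G(4) unfolding HH by (meson le_trans mult_le_mono2)
    also have "\<dots> \<le> 2 * card K ^ card E * ex_number r n H (complete_partite (s @ [p]))"
      by (intro mult_le_mono2 card_copies_le_ex_number G(1-3))
    finally show ?thesis by (simp only: K(2))
  qed
  then show ?thesis unfolding k_def V_def E_def by blast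
qed

text \<open>Take the last power of two that fits. The next one is too large, so restricting field
  sizes to powers of two costs only the constant factor \<open>2 ^ k\<close>.\<close>

lemma dyadic_scale:
  fixes W k a0 n :: nat
  assumes "0 < k" "0 < W" "W * (2 ^ a0) ^ k \<le> n"
  obtains a where "a0 \<le> a" "W * (2 ^ a) ^ k \<le> n" "n < W * 2 ^ k * (2 ^ a) ^ k"
proof -
  let ?P = "\<lambda>a. n < W * (2 ^ a) ^ k"
  have "n < 2 ^ n" by (rule less_exp)
  also have "\<dots> = 1 * (2 ^ n) ^ 1" by simp
  also have "\<dots> \<le> W * (2 ^ n) ^ k" using assms(1,2) by (intro mult_le_mono power_increasing) auto
  finally have "?P n" .
  then obtain b where b: "\<forall>i<b. \<not> ?P i" "?P b" using ex_least_nat_le[of ?P n] by blast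
  have "a0 < b"
  proof (rule ccontr)
    assume "\<not> a0 < b"
    then have "W * (2 ^ b) ^ k \<le> W * (2 ^ a0) ^ k"
      by (intro mult_le_mono2 power_mono power_increasing) auto
    then show False using assms(3) b(2) by linarith
  qed
  then obtain a where a: "b = Suc a" "a0 \<le> a" by (cases b) auto
  show thesis
  proof (rule that[OF a(2)])
    show "W * (2 ^ a) ^ k \<le> n" using b(1) a(1) by (simp add: not_less)
    show "n < W * 2 ^ k * (2 ^ a) ^ k" using b(2) a(1) by (simp add: power_mult_distrib mult.assoc)
  qed
qed

text \<open>The exponent may be negative, and then it is the upper bound on \<open>Q\<close> that
  counts; hence the minimum.\<close>

lemma powr_sandwich:
  fixes Q y x \<alpha> \<beta> :: real
  assumes "0 < y" "0 < \<alpha>" "0 < \<beta>" "\<alpha> * y \<le> Q" "Q \<le> \<beta> * y"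
  shows "min (\<alpha> powr x) (\<beta> powr x) * y powr x \<le> Q powr x"
proof (cases "0 \<le> x")
  case True
  have "min (\<alpha> powr x) (\<beta> powr x) * y powr x \<le> \<alpha> powr x * y powr x" by (intro mult_right_mono) auto
  also have "\<dots> = (\<alpha> * y) powr x" using assms by (simp add: powr_mult)
  also have "\<dots> \<le> Q powr x" using assms True by (intro powr_mono2) auto
  finally show ?thesis .
next
  case False
  have "0 < Q" using assms by (meson less_le_trans mult_pos_pos)
  have "min (\<alpha> powr x) (\<beta> powr x) * y powr x \<le> \<beta> powr x * y powr x" by (intro mult_right_mono) auto
  also have "\<dots> = (\<beta> * y) powr x" using assms by (simp add: powr_mult)
  also have "\<dots> \<le> Q powr x" using assms False \<open>0 < Q\<close> by (intro powr_mono2') auto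
  finally show ?thesis .
qed

theorem theorem1p4:
  fixes r :: nat and s :: "nat list" and H :: "'a hypergraph"
  assumes "r \<ge> 2"
    and "length s = r - 1" and "\<forall>x\<in>set s. x > 0"
    and "uniform_hypergraph r H"
  shows "\<exists>c::real. c > 0 \<and> (\<forall>p::nat. real p \<ge> c \<longrightarrow>
           (\<lambda>n. real (ex_number r n H (complete_partite (s @ [p]))))
             \<in> \<Omega>(\<lambda>n. real n powr
                 (real (card (verts H)) - real (card (edges H)) / real (prod_list s))))"
proof -
  define v where "v = card (verts H)"
  define m where "m = card (edges H)"
  define k where "k = prod_list s"
  define x where "x = real v - real m / real k"
  have k: "0 < k" using assms(3) unfolding k_def by (induction s) auto
  have r: "1 \<le> r" using assms(1) by simp
  obtain C q0 where bound: "\<And>p a n. v * C < p \<Longrightarrow> q0 \<le> a \<Longrightarrow> v * (2 ^ a) ^ k \<le> n \<Longrightarrow>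
      (2 ^ a) ^ (k * v) \<le> 2 * (2 ^ a) ^ m * ex_number r n H (complete_partite (s @ [p]))"
    using ex_number_lower_bound[OF r assms(2-4)] unfolding v_def m_def k_def by blast
  \<comment> \<open>\<open>Suc v\<close> instead of \<open>v\<close> keeps the scale positive when
    \<open>H\<close> has no vertices.\<close>
  define W where "W = Suc v"
  define \<alpha> where "\<alpha> = 1 / (real W * 2 ^ k)"
  define \<beta> where "\<beta> = 1 / real W"
  define \<kappa> where "\<kappa> = min (\<alpha> powr x) (\<beta> powr x) / 2"
  have pos: "0 < \<alpha>" "0 < \<beta>" "0 < W" by (auto simp: \<alpha>_def \<beta>_def W_def)
  have \<kappa>: "0 < \<kappa>" using pos by (simp add: \<kappa>_def)
  have main: "\<kappa> * real n powr x \<le> real (ex_number r n H (complete_partite (s @ [p])))"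
    if p: "v * C < p" and n: "W * (2 ^ q0) ^ k \<le> n" for p n
  proof -
    obtain a where a: "q0 \<le> a" "W * (2 ^ a) ^ k \<le> n" "n < W * 2 ^ k * (2 ^ a) ^ k"
      using dyadic_scale[OF k pos(3) n] by blast
    define q where "q = (2::real) ^ a"
    define Q where "Q = q ^ k"
    have q: "0 < q" by (simp add: q_def)
    have "0 < W * (2 ^ q0) ^ k" using pos(3) by simp
    then have n0: "0 < n" using n by linarith
    have "real (W * (2 ^ a) ^ k) \<le> real n" using a(2) by (simp only: of_nat_le_iff)
    then have Q1: "Q \<le> \<beta> * real n" using pos(3) by (simp add: \<beta>_def Q_def q_def field_simps)
    have "real n < real (W * 2 ^ k * (2 ^ a) ^ k)" using a(3) by (simp only: of_nat_less_iff)
    then have Q2: "\<alpha> * real n \<le> Q" using pos(3) by (simp add: \<alpha>_def Q_def q_def field_simps)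
    have "v * (2 ^ a) ^ k \<le> n" using a(2) by (simp add: W_def)
    then have "(2 ^ a) ^ (k * v) \<le> 2 * (2 ^ a) ^ m * ex_number r n H (complete_partite (s @ [p]))"
      by (rule bound[OF p a(1)])
    then have "real ((2 ^ a) ^ (k * v)) \<le>
        real (2 * (2 ^ a) ^ m * ex_number r n H (complete_partite (s @ [p])))"
      by (simp only: of_nat_le_iff)
    then have E: "q ^ (k * v) \<le> 2 * q ^ m * real (ex_number r n H (complete_partite (s @ [p])))"
      by (simp add: q_def)
    \<comment> \<open>\<open>Q = q ^ k\<close> has the order of \<open>n\<close>, and
      \<open>k * x\<close> is the integer \<open>k * v - m\<close>, which matches the counting bound
      \<open>E\<close>.\<close>
    have "Q powr x = q powr (real k * x)"
      using q by (simp add: Q_def powr_realpow[symmetric] powr_powr)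
    also have "real k * x = real (k * v) - real m" using k by (simp add: x_def field_simps)
    also have "q powr \<dots> = q ^ (k * v) / q ^ m"
      using q by (simp add: powr_diff powr_realpow flip: of_nat_mult)
    also have "\<dots> \<le> 2 * real (ex_number r n H (complete_partite (s @ [p])))"
      using E q by (simp add: field_simps)
    finally have "Q powr x \<le> 2 * real (ex_number r n H (complete_partite (s @ [p])))" .
    moreover have "2 * \<kappa> * real n powr x \<le> Q powr x"
      using powr_sandwich[of "real n" \<alpha> \<beta> Q x] n0 pos Q1 Q2 by (simp add: \<kappa>_def)
    ultimately show ?thesis by simp
  qed
  \<comment> \<open>The summand 1 makes the threshold positive and yields the strict inequality
    \<open>v * C < p\<close>.\<close>
  have "(\<lambda>n. real (ex_number r n H (complete_partite (s @ [p])))) \<in> \<Omega>(\<lambda>n. real n powr x)"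
    if "real p \<ge> real (v * C + 1)" for p
  proof (rule landau_omega.bigI[OF \<kappa>])
    have p: "v * C < p" using that by linarith
    show "\<forall>\<^sub>F n in sequentially. \<kappa> * norm (real n powr x) \<le>
        norm (real (ex_number r n H (complete_partite (s @ [p]))))"
      using eventually_ge_at_top[of "W * (2 ^ q0) ^ k"] by eventually_elim (use main[OF p] in simp)
  qed
  then show ?thesis
    unfolding x_def v_def m_def k_def by (intro exI[of _ "real (card (verts H) * C + 1)"]) (auto intro!: add_pos_nonneg)
qed

end
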